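(* Let $d\ge 1$ be a fixed integer and let $n$ be a positive integer. Consider the distribution of the number of summands among all simple jump paths of dimension $d$ with starting point $(i,i,\dots,i)$ where $1\le i\le n$, each of which represents a (not necessarily unique) decomposition of some positive number. That is, let $K_n$ be the number of summands of a path chosen uniformly at random from the set of all $d$-dimensional simple jump paths whose starting point is $(i,i,\dots,i)$ for some $i$ with $1\le i\le n$. Then this distribution converges to a Gaussian as $n\to\infty$; that is, $\dfrac{K_n-\mathbb{E}[K_n]}{\sqrt{\operatorname{Var}(K_n)}}$ (defined for $n\ge 2$) converges in distribution to a standard normal random variable as $n\to\infty$.
   Context: A $d$-dimensional simple jump path of length $k\ge 1$ (i.e. with $k$ steps) starting at $(a_1,\dots,a_d)$, where the $a_j$ are positive integers, is a sequence of points $\{(x_{i,1},\dots,x_{i,d})\}_{i=0}^{k}$, each either a lattice point with all coordinates positive integers or the origin, such that $(x_{0,1},\dots,x_{0,d})=(a_1,\dots,a_d)$, $(x_{k,1},\dots,x_{k,d})=(0,\dots,0)$, and $x_{i,j}>x_{i+1,j}$ for all $i\in\{0,\dots,k-1\}$ and all $j\in\{1,\dots,d\}$ (every coordinate strictly decreases at every step). The origin is an extra terminal point appended to every path; the summands are the points of the path other than the origin, so a path with $k$ steps has exactly $k$ summands. Decompositions: the lattice points with positive integer coordinates are labelled by positive integers, by filling the points in a fixed order (for example, when $d=2$, along successive diagonals), starting with the label $1$ and running through the natural numbers, where a number is assigned to the next point exactly when it is not the sum of the labels along any collection of already labelled points in which all coordinates strictly decrease from each point to the next. A simple jump path represents a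 decomposition of the number equal to the sum of the labels of its points other than the origin; a number may have more than one such decomposition. The number of summands does not depend on the choice of ordering or labels. *)

theory Defs
  imports "HOL-Probability.Probability"
begin

text \<open>
  The dimension $d$ is \<^term>\<open>CARD('d)\<close> for a finite index type \<^typ>\<open>'d\<close>, so $d \ge 1$ holds
  automatically and the theorem is universally quantified over $d$.
\<close>

definition positive_points :: "(nat ^ 'd::finite) set" where
  "positive_points = {x. \<forall>j. 0 < x $ j}"

definition strictly_below :: "nat ^ 'd::finite \<Rightarrow> nat ^ 'd \<Rightarrow> bool" where
  "strictly_below y x \<longleftrightarrow> (\<forall>j. y $ j < x $ j)"

definition simple_jump_path :: "nat ^ 'd::finite \<Rightarrow> nat \<Rightarrow> (nat ^ 'd) list \<Rightarrow> bool" where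
  "simple_jump_path a k xs \<longleftrightarrow>
     1 \<le> k \<and> a \<in> positive_points \<and> length xs = Suc k \<and>
     (\<forall>x \<in> set xs. x \<in> positive_points \<or> x = 0) \<and>
     xs ! 0 = a \<and> xs ! k = 0 \<and>
     (\<forall>i<k. strictly_below (xs ! Suc i) (xs ! i))"

definition summands :: "(nat ^ 'd::finite) list \<Rightarrow> (nat ^ 'd) list" where
  "summands xs = filter (\<lambda>x. x \<noteq> 0) xs"

definition num_summands :: "(nat ^ 'd::finite) list \<Rightarrow> real" where
  "num_summands xs = real (length (summands xs))"

definition diagonal_paths :: "nat \<Rightarrow> (nat ^ 'd::finite) list set" where
  "diagonal_paths n = {xs. \<exists>i\<in>{1..n}. \<exists>k. simple_jump_path (\<chi> j. i) k xs}"

text \<open>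
  \<^term>\<open>e\<close> is the order in which the points are filled and \<^term>\<open>L\<close> assigns the labels.  When the
  number \<^term>\<open>N\<close> is considered, the already labelled points are those with a label below
  \<^term>\<open>N\<close>; strict monotonicity along \<^term>\<open>e\<close> says that each assigned number goes to the next
  point of the order.
\<close>

definition jump_labelling :: "(nat \<Rightarrow> nat ^ 'd::finite) \<Rightarrow> (nat ^ 'd \<Rightarrow> nat) \<Rightarrow> bool" where
  "jump_labelling e L \<longleftrightarrow>
     bij_betw e UNIV positive_points \<and>
     L (e 0) = 1 \<and> strict_mono (\<lambda>m. L (e m)) \<and>
     (\<forall>N>0. (\<exists>m. L (e m) = N) \<longleftrightarrow>
        \<not> (\<exists>ps. set ps \<subseteq> {x \<in> positive_points. L x < N} \<and>
                 sorted_wrt (\<lambda>x y. strictly_below y x) ps \<and>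
                 sum_list (map L ps) = N))"

definition represents :: "(nat ^ 'd::finite \<Rightarrow> nat) \<Rightarrow> (nat ^ 'd) list \<Rightarrow> nat \<Rightarrow> bool" where
  "represents L xs N \<longleftrightarrow> N = sum_list (map L (summands xs))"

text \<open>
  For \<^term>\<open>n = 0\<close> there is no path and for \<^term>\<open>n = 1\<close> the variance is zero, so the values of
  the following two functions are meaningful only for \<^term>\<open>n \<ge> 1\<close> and \<^term>\<open>n \<ge> 2\<close>
  respectively; this does not affect limits as \<^term>\<open>n\<close> tends to infinity.
\<close>

definition path_pmf :: "nat \<Rightarrow> (nat ^ 'd::finite) list pmf" where
  "path_pmf n = pmf_of_set (diagonal_paths n)"

definition standardized_num_summands :: "nat \<Rightarrow> (nat ^ 'd::finite) list \<Rightarrow> real" where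
  "standardized_num_summands n xs =
     (num_summands xs - measure_pmf.expectation (path_pmf n :: (nat ^ 'd) list pmf) num_summands)
       / sqrt (measure_pmf.variance (path_pmf n :: (nat ^ 'd) list pmf) num_summands)"

end

theory Submission
  imports Defs
begin

text \<open>
  Write $d$ for the dimension. Compositions of $i$ into $k$ positive parts number
  $\binom{i-1}{k-1}$, and a path with $k$ steps from $(i,\dots,i)$ is an independent choice of one
  such composition per coordinate, so there are $\binom{i-1}{k-1}^d$ of them (lemma
  \<open>card_paths\<close>). With $M = i-1$ and $J = k-1$, the pair $(M,J)$ attached to a uniformly random
  path therefore has probability proportional to $\binom{m}{j}^d$ on the triangle
  $j \le m < n$ (theorem \<open>expectation_num_summands\<close>), and the number of summands is $J+1$.

  For fixed $M = m$ put $Y = J - m/2$ and $u = 2Y/m$. Since consecutive weights have ratio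
  $((m-j)/(j+1))^d$, shifting the summation index gives a Stein identity
  \[ E[(1-u)^d f(J+1)] = E[(1+u)^d f(J)] \quad\mbox{for every } f \]
  (lemma \<open>row_avg_stein\<close>). As $(1+u)^d - (1-u)^d$ is $2du$ up to a cubic error, and has
  the sign of $u$ and absolute value at least $2d|u|$, the choices $f = Y$ and $f = Y^3$ bound the second and fourth
  moments and yield $E[Y^2] = m/(4d) + O(\sqrt m)$. The choice $f = e^{itZ}$ with
  $Z = 2\sqrt{d/m}\,Y$ says that the characteristic function $\varphi_m$ of $Z$ satisfies
  $\varphi_m' = -t\varphi_m + O(m^{-1/2})$, so $\varphi_m(t) \to e^{-t^2/2}$
  (theorem \<open>row_char_tendsto\<close>).

  The total weight of a row at least doubles from each row to the next, hence $n - M$ has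
  a second moment bounded uniformly in $n$ (lemma \<open>len_avg_gap_sq_le\<close>), while every fixed row has
  vanishing probability. The latter carries the limit of $\varphi_m$ over to the mixture of the
  rows; the former shows that replacing the row-wise centre $M/2$ and scale $\sqrt{M/(4d)}$ by the
  mean and standard deviation of the mixture changes the standardised variable by a quantity
  that tends to $0$ in mean (theorem \<open>tri_char_tendsto\<close>). Levy's continuity theorem concludes.
\<close>

section \<open>Finite weighted averages\<close>

text \<open>
  The weights are left unnormalised because they will be counts. Values in an arbitrary real
  vector space let the same lemmas serve real moments and complex characteristic functions.
\<close>

definition wavg :: "'a set \<Rightarrow> ('a \<Rightarrow> real) \<Rightarrow> ('a \<Rightarrow> 'b::real_vector) \<Rightarrow> 'b" where
  "wavg I w f = (\<Sum>i\<in>I. w i *\<^sub>R f i) /\<^sub>R sum w I"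

definition weights :: "'a set \<Rightarrow> ('a \<Rightarrow> real) \<Rightarrow> bool" where
  "weights I w \<longleftrightarrow> finite I \<and> (\<forall>i\<in>I. 0 \<le> w i) \<and> 0 < sum w I"

lemma wavg_cong: "(\<And>i. i \<in> I \<Longrightarrow> f i = g i) \<Longrightarrow> wavg I w f = wavg I w g"
  unfolding wavg_def by (intro arg_cong2[where f=scaleR] sum.cong refl) auto

lemma wavg_add: "wavg I w (\<lambda>i. f i + g i) = wavg I w f + wavg I w g"
  by (simp add: wavg_def scaleR_add_right sum.distrib)

lemma wavg_diff: "wavg I w (\<lambda>i. f i - g i) = wavg I w f - wavg I w g"
  by (simp add: wavg_def scaleR_diff_right sum_subtractf)

lemma wavg_cmult: "wavg I w (\<lambda>i. c * f i) = c * wavg I w (f :: 'a \<Rightarrow> 'b::real_algebra)"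
  by (simp add: wavg_def sum_distrib_left)

lemma wavg_const: "weights I w \<Longrightarrow> wavg I w (\<lambda>i. c) = c"
  by (simp add: wavg_def weights_def flip: scaleR_sum_left)

lemma wavg_mono:
  fixes f g :: "'a \<Rightarrow> real"
  assumes "weights I w" "\<And>i. i \<in> I \<Longrightarrow> f i \<le> g i"
  shows "wavg I w f \<le> wavg I w g"
  using assms unfolding wavg_def weights_def
  by (auto intro!: mult_left_mono sum_mono)

lemma norm_wavg_le:
  fixes f :: "'a \<Rightarrow> 'b::real_normed_vector"
  assumes "weights I w" "\<And>i. i \<in> I \<Longrightarrow> norm (f i) \<le> g i"
  shows "norm (wavg I w f) \<le> wavg I w g"
proof -
  have "norm (\<Sum>i\<in>I. w i *\<^sub>R f i) \<le> (\<Sum>i\<in>I. w i * g i)"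
    using assms by (intro sum_norm_le) (auto simp: weights_def intro!: mult_left_mono)
  then show ?thesis
    using assms(1) by (auto simp: wavg_def weights_def divide_right_mono field_simps)
qed

lemma wavg_nonneg:
  fixes f :: "'a \<Rightarrow> real"
  assumes "weights I w" "\<And>i. i \<in> I \<Longrightarrow> 0 \<le> f i"
  shows "0 \<le> wavg I w f"
  using wavg_mono[of I w "\<lambda>_. 0" f] assms by (simp add: wavg_const)

lemma wavg_le_const:
  fixes f :: "'a \<Rightarrow> real"
  assumes "weights I w" "\<And>i. i \<in> I \<Longrightarrow> f i \<le> c"
  shows "wavg I w f \<le> c"
  using wavg_mono[of I w f "\<lambda>_. c"] assms by (simp add: wavg_const)

lemma has_vector_derivative_wavg:
  fixes f :: "'a \<Rightarrow> real \<Rightarrow> 'b::real_normed_vector"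
  assumes "\<And>i. i \<in> I \<Longrightarrow> (f i has_vector_derivative f' i) (at t)"
  shows "((\<lambda>t. wavg I w (\<lambda>i. f i t)) has_vector_derivative wavg I w f') (at t)"
  unfolding wavg_def
  by (auto intro!: derivative_eq_intros assms sum.cong simp: scaleR_sum_right)

text \<open>
  Conditioning: the outer index is weighted by the total weight of its fibre.
\<close>

lemma wavg_Sigma:
  assumes "finite I" "\<And>i. i \<in> I \<Longrightarrow> weights (J i) (w i)"
  shows "wavg (Sigma I J) (\<lambda>(i, j). w i j) f =
         wavg I (\<lambda>i. sum (w i) (J i)) (\<lambda>i. wavg (J i) (w i) (\<lambda>j. f (i, j)))"
proof -
  have fin: "\<forall>i\<in>I. finite (J i)" using assms by (auto simp: weights_def)
  have "(\<Sum>x\<in>Sigma I J. (case x of (i, j) \<Rightarrow> w i j) *\<^sub>R f x) = (\<Sum>i\<in>I. \<Sum>j\<in>J i. w i j *\<^sub>R f (i, j))"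
    using assms(1) fin by (subst sum.Sigma) (auto intro!: sum.cong)
  also have "\<dots> = (\<Sum>i\<in>I. sum (w i) (J i) *\<^sub>R wavg (J i) (w i) (\<lambda>j. f (i, j)))"
    using assms(2) by (intro sum.cong refl) (force simp: wavg_def weights_def)
  finally show ?thesis
    using assms(1) fin by (simp add: wavg_def sum.Sigma)
qed

section \<open>Elementary inequalities\<close>

text \<open>
  The expansion of $(1+u)^d - (1-u)^d$ has only odd powers of $u$, all with nonnegative
  coefficients, and starts with $2du$. The even part is carried along to make the induction work.
\<close>

lemma binomial_odd_part_lower:
  fixes u :: real
  shows "2 * real d * u\<^sup>2 \<le> u * ((1 + u) ^ d - (1 - u) ^ d) \<and> 2 \<le> (1 + u) ^ d + (1 - u) ^ d"
proof (induction d)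
  case (Suc d)
  let ?D = "(1 + u) ^ d - (1 - u) ^ d" and ?S = "(1 + u) ^ d + (1 - u) ^ d"
  have D: "(1 + u) ^ Suc d - (1 - u) ^ Suc d = ?D + u * ?S"
    and S: "(1 + u) ^ Suc d + (1 - u) ^ Suc d = ?S + u * ?D"
    by (simp_all add: algebra_simps)
  have "u\<^sup>2 * 2 \<le> u\<^sup>2 * ?S" using Suc by (intro mult_left_mono) auto
  moreover have "0 \<le> 2 * real d * u\<^sup>2" by simp
  ultimately show ?case
    using Suc unfolding D S by (simp add: algebra_simps power2_eq_square)
qed simp

text \<open>
  The quadratic terms cancel in the odd part. With a cubic error the remainder in the asymptotics of
  the variance is a multiple of the fourth moment. The even part again serves the induction.
\<close>

lemma binomial_odd_part_approx:
  fixes u :: real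
  assumes u: "\<bar>u\<bar> \<le> 1"
  shows "\<bar>(1 + u) ^ d - (1 - u) ^ d - 2 * real d * u\<bar> \<le> 4 ^ d * \<bar>u\<bar> ^ 3 \<and>
         \<bar>(1 + u) ^ d + (1 - u) ^ d - 2\<bar> \<le> 4 ^ d * u\<^sup>2"
proof (induction d)
  case (Suc d)
  let ?D = "(1 + u) ^ d - (1 - u) ^ d" and ?S = "(1 + u) ^ d + (1 - u) ^ d"
  have D: "(1 + u) ^ Suc d - (1 - u) ^ Suc d = ?D + u * ?S"
    and S: "(1 + u) ^ Suc d + (1 - u) ^ Suc d = ?S + u * ?D"
    by (simp_all add: algebra_simps)
  have d: "2 * real d \<le> 2 * 4 ^ d"
    using less_exp[of d] power_mono[of 2 "4::real" d] of_nat_less_iff[of d "2^d", where 'a=real]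
    by (auto simp del: of_nat_less_iff)
  have cube: "\<bar>u\<bar> ^ 3 = \<bar>u\<bar> * u\<^sup>2" by (simp add: power3_eq_cube power2_eq_square abs_mult_self_eq)
  have u2: "u\<^sup>2 \<le> 1" using u by (simp add: abs_square_le_1)
  have "\<bar>?D + u * ?S - 2 * real (Suc d) * u\<bar> \<le> \<bar>?D - 2 * real d * u\<bar> + \<bar>u\<bar> * \<bar>?S - 2\<bar>"
    unfolding abs_mult[symmetric] by (simp add: algebra_simps)
  also have "\<dots> \<le> 4 ^ d * \<bar>u\<bar> ^ 3 + \<bar>u\<bar> * (4 ^ d * u\<^sup>2)"
    using Suc by (intro add_mono mult_left_mono) auto
  also have "\<dots> = 2 * 4 ^ d * \<bar>u\<bar> ^ 3" by (simp add: cube)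
  also have "\<dots> \<le> 4 ^ Suc d * \<bar>u\<bar> ^ 3" by (intro mult_right_mono) auto
  finally have 1: "\<bar>?D + u * ?S - 2 * real (Suc d) * u\<bar> \<le> 4 ^ Suc d * \<bar>u\<bar> ^ 3" .
  have "\<bar>?S + u * ?D - 2\<bar> \<le> \<bar>?S - 2\<bar> + \<bar>u\<bar> * (\<bar>?D - 2 * real d * u\<bar> + 2 * real d * \<bar>u\<bar>)"
  proof -
    have "\<bar>?D\<bar> \<le> \<bar>?D - 2 * real d * u\<bar> + \<bar>2 * real d * u\<bar>" by linarith
    then have "\<bar>u\<bar> * \<bar>?D\<bar> \<le> \<bar>u\<bar> * (\<bar>?D - 2 * real d * u\<bar> + 2 * real d * \<bar>u\<bar>)"
      by (intro mult_left_mono) (auto simp: abs_mult)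
    moreover have "\<bar>?S + u * ?D - 2\<bar> \<le> \<bar>?S - 2\<bar> + \<bar>u * ?D\<bar>" by linarith
    ultimately show ?thesis by (simp only: abs_mult)
  qed
  also have "\<dots> \<le> 4 ^ d * u\<^sup>2 + \<bar>u\<bar> * (4 ^ d * \<bar>u\<bar> ^ 3 + 2 * 4 ^ d * \<bar>u\<bar>)"
    using Suc d by (intro add_mono mult_left_mono mult_right_mono) auto
  also have "\<dots> = 4 ^ d * u\<^sup>2 * (3 + u\<^sup>2)"
    by (simp add: cube algebra_simps power2_eq_square abs_mult_self_eq)
  also have "\<dots> \<le> 4 ^ d * u\<^sup>2 * 4"
    using u2 by (intro mult_left_mono) auto
  finally have 2: "\<bar>?S + u * ?D - 2\<bar> \<le> 4 ^ Suc d * u\<^sup>2" by (simp add: mult_ac)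
  show ?case unfolding D S using 1 2 by blast
qed simp

lemma power_one_minus_approx:
  fixes u :: real
  assumes u: "\<bar>u\<bar> \<le> 1"
  shows "\<bar>(1 - u) ^ d - 1\<bar> \<le> (2 ^ d - 1) * \<bar>u\<bar>"
proof (induction d)
  case (Suc d)
  have "\<bar>(1 - u) ^ Suc d - 1\<bar> = \<bar>(1 - u) * ((1 - u) ^ d - 1) - u\<bar>" by (simp add: algebra_simps)
  also have "\<dots> \<le> \<bar>1 - u\<bar> * \<bar>(1 - u) ^ d - 1\<bar> + \<bar>u\<bar>" unfolding abs_mult[symmetric] by linarith
  also have "\<dots> \<le> 2 * ((2 ^ d - 1) * \<bar>u\<bar>) + \<bar>u\<bar>"
    using Suc u by (intro add_mono mult_mono) auto
  finally show ?case by (simp add: algebra_simps)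
qed simp

section \<open>Powers of binomial coefficients in one row\<close>

definition row_avg :: "nat \<Rightarrow> nat \<Rightarrow> (nat \<Rightarrow> 'b::real_vector) \<Rightarrow> 'b" where
  "row_avg d m = wavg {..m} (\<lambda>j. real (m choose j) ^ d)"

text \<open>
  The centre of symmetry of row \<open>m\<close> is \<open>m / 2\<close>, which is therefore the mean of the row for every
  exponent.
\<close>

definition dev :: "nat \<Rightarrow> nat \<Rightarrow> real" where
  "dev m j = real j - real m / 2"

lemma weights_row: "weights {..m} (\<lambda>j. real (m choose j) ^ d)"
  unfolding weights_def by (auto intro!: sum_pos)

lemmas row_avg_cong = wavg_cong[where I = "{..m}" and w = "\<lambda>j. real (m choose j) ^ d" for m d, folded row_avg_def]
lemmas row_avg_add = wavg_add[where I = "{..m}" and w = "\<lambda>j. real (m choose j) ^ d" for m d, folded row_avg_def]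
lemmas row_avg_diff = wavg_diff[where I = "{..m}" and w = "\<lambda>j. real (m choose j) ^ d" for m d, folded row_avg_def]
lemmas row_avg_cmult = wavg_cmult[where I = "{..m}" and w = "\<lambda>j. real (m choose j) ^ d" for m d, folded row_avg_def]
lemmas row_avg_const = wavg_const[OF weights_row, folded row_avg_def]
lemmas row_avg_mono = wavg_mono[OF weights_row, folded row_avg_def]
lemmas norm_row_avg_le = norm_wavg_le[OF weights_row, folded row_avg_def]
lemmas row_avg_nonneg = wavg_nonneg[OF weights_row, folded row_avg_def]
lemmas row_avg_le_const = wavg_le_const[OF weights_row, folded row_avg_def]

text \<open>
  By absorption $(m-j)\binom{m}{j} = (j+1)\binom{m}{j+1}$, both sides are the same sum up to the
  shift $j \mapsto j+1$; the boundary terms vanish because $d \ge 1$.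
\<close>

lemma row_avg_shift:
  fixes f :: "nat \<Rightarrow> 'b::real_vector"
  assumes "1 \<le> d"
  shows "row_avg d m (\<lambda>j. real (m - j) ^ d *\<^sub>R f (Suc j)) = row_avg d m (\<lambda>j. real j ^ d *\<^sub>R f j)"
proof -
  have absorb: "real (m choose j) ^ d * real (m - j) ^ d = real (m choose Suc j) ^ d * real (Suc j) ^ d" for j
    by (metis binomial_absorb_comp binomial_absorption mult.commute of_nat_mult power_mult_distrib)
  have "(\<Sum>j\<le>m. real (m choose j) ^ d *\<^sub>R real (m - j) ^ d *\<^sub>R f (Suc j)) =
        (\<Sum>j\<le>m. (real (m choose Suc j) ^ d * real (Suc j) ^ d) *\<^sub>R f (Suc j))"
    by (simp only: scaleR_scaleR absorb)
  also have "\<dots> = (\<Sum>j\<le>Suc m. (real (m choose j) ^ d * real j ^ d) *\<^sub>R f j)"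
    using assms by (simp only: sum.atMost_Suc_shift) simp
  also have "\<dots> = (\<Sum>j\<le>m. real (m choose j) ^ d *\<^sub>R real j ^ d *\<^sub>R f j)"
    using assms by simp
  finally show ?thesis by (simp add: row_avg_def wavg_def)
qed

text \<open>
  The Stein identity of the row: division of \<open>row_avg_shift\<close> by $(m/2)^d$ turns the
  factors $m-j$ and $j$ into $1-u$ and $1+u$ for the relative deviation $u$, which lies in $[-1,1]$.
\<close>

lemma row_avg_stein:
  fixes f :: "nat \<Rightarrow> 'b::real_vector"
  assumes "1 \<le> d" "1 \<le> m"
  defines "u \<equiv> \<lambda>j. 2 * dev m j / real m"
  shows "row_avg d m (\<lambda>j. (1 - u j) ^ d *\<^sub>R f (Suc j)) = row_avg d m (\<lambda>j. (1 + u j) ^ d *\<^sub>R f j)"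
proof -
  let ?c = "(2 / real m) ^ d"
  have 1: "1 - u j = 2 / real m * real (m - j)" if "j \<le> m" for j
    using that assms(2) by (simp add: u_def dev_def field_simps of_nat_diff)
  have 2: "1 + u j = 2 / real m * real j" for j
    using assms(2) by (simp add: u_def dev_def field_simps)
  have "row_avg d m (\<lambda>j. (1 - u j) ^ d *\<^sub>R f (Suc j)) =
        row_avg d m (\<lambda>j. real (m - j) ^ d *\<^sub>R ?c *\<^sub>R f (Suc j))"
    by (rule row_avg_cong) (simp add: 1 power_mult_distrib power_divide mult.commute del: of_nat_diff)
  also have "\<dots> = row_avg d m (\<lambda>j. real j ^ d *\<^sub>R ?c *\<^sub>R f j)"
    by (rule row_avg_shift[OF assms(1)])
  also have "\<dots> = row_avg d m (\<lambda>j. (1 + u j) ^ d *\<^sub>R f j)"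
    by (rule row_avg_cong) (simp add: 2 power_mult_distrib power_divide mult.commute)
  finally show ?thesis .
qed

lemma row_avg_dev: "row_avg d m (dev m) = 0"
proof -
  have "(\<Sum>j\<le>m. real (m choose j) ^ d * dev m j) = (\<Sum>j\<le>m. real (m choose (m - j)) ^ d * dev m (m - j))"
    by (rule sum.reindex_bij_witness[of _ "\<lambda>j. m - j" "\<lambda>j. m - j"]) auto
  also have "\<dots> = (\<Sum>j\<le>m. - (real (m choose j) ^ d * dev m j))"
    by (rule sum.cong) (auto simp: dev_def of_nat_diff binomial_symmetric[symmetric] algebra_simps)
  finally have "(\<Sum>j\<le>m. real (m choose j) ^ d * dev m j) = 0" by (simp add: sum_negf)
  then show ?thesis by (simp add: row_avg_def wavg_def)
qed

lemma abs_dev_le: "j \<le> m \<Longrightarrow> \<bar>2 * dev m j / real m\<bar> \<le> 1"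
  by (cases "m = 0") (auto simp: dev_def field_simps abs_le_iff)

text \<open>
  The Stein identity for $g(j)\,Y$, where $Y((1+u)^d-(1-u)^d) \ge 4dY^2/m$. The weight $g = 1$ will
  bound the second moment and $g = Y^2$ the fourth.
\<close>

lemma row_avg_weighted_second_moment:
  fixes g :: "nat \<Rightarrow> real"
  assumes "1 \<le> d" "1 \<le> m" and g: "\<And>j. g j \<ge> 0"
  defines "u \<equiv> \<lambda>j. 2 * dev m j / real m"
  shows "4 * real d / real m * row_avg d m (\<lambda>j. g j * dev m j ^ 2) \<le>
         row_avg d m (\<lambda>j. (1 - u j) ^ d * (g (Suc j) * dev m (Suc j) - g j * dev m j))"
proof -
  have "row_avg d m (\<lambda>j. (1 - u j) ^ d * (g (Suc j) * dev m (Suc j) - g j * dev m j)) =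
        row_avg d m (\<lambda>j. (1 + u j) ^ d * (g j * dev m j)) - row_avg d m (\<lambda>j. (1 - u j) ^ d * (g j * dev m j))"
    using row_avg_stein[of d m "\<lambda>j. g j * dev m j"] assms(1,2)
    by (simp add: row_avg_diff right_diff_distrib u_def)
  also have "\<dots> = row_avg d m (\<lambda>j. g j * dev m j * ((1 + u j) ^ d - (1 - u j) ^ d))"
    by (simp add: row_avg_diff[symmetric] algebra_simps)
  also have "\<dots> \<ge> row_avg d m (\<lambda>j. 4 * real d / real m * (g j * dev m j ^ 2))"
  proof (rule row_avg_mono)
    fix j
    have dv: "dev m j = real m / 2 * u j" using assms(2) by (simp add: u_def)
    have "g j * (real m / 2) * (2 * real d * (u j)\<^sup>2) \<le>
          g j * (real m / 2) * (u j * ((1 + u j) ^ d - (1 - u j) ^ d))"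
      using binomial_odd_part_lower[of d "u j"] g by (intro mult_left_mono) auto
    then show "4 * real d / real m * (g j * dev m j ^ 2) \<le> g j * dev m j * ((1 + u j) ^ d - (1 - u j) ^ d)"
      using assms(2) unfolding dv by (simp add: power2_eq_square field_simps)
  qed
  finally show ?thesis by (simp only: row_avg_cmult)
qed

lemma power_one_minus_bounds:
  assumes "j \<le> m"
  shows "0 \<le> (1 - 2 * dev m j / real m) ^ d" "(1 - 2 * dev m j / real m) ^ d \<le> 2 ^ d"
  using abs_dev_le[OF assms] unfolding abs_le_iff by (auto intro!: zero_le_power power_mono)

lemma row_avg_dev_sq_le:
  assumes d: "1 \<le> d"
  shows "4 * real d * row_avg d m (\<lambda>j. dev m j ^ 2) \<le> 2 ^ d * real m"
proof (cases "m = 0")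
  case True
  then show ?thesis by (simp add: row_avg_def wavg_def dev_def)
next
  case False
  have "4 * real d / real m * row_avg d m (\<lambda>j. dev m j ^ 2) \<le>
        row_avg d m (\<lambda>j. (1 - 2 * dev m j / real m) ^ d)"
    using row_avg_weighted_second_moment[of d m "\<lambda>_. 1"] d False by (simp add: dev_def)
  also have "\<dots> \<le> 2 ^ d"
    by (intro row_avg_le_const power_one_minus_bounds) auto
  finally show ?thesis using False by (simp add: field_simps)
qed

lemma row_avg_dev_sq_nonneg: "0 \<le> row_avg d m (\<lambda>j. dev m j ^ 2)"
  by (intro row_avg_nonneg) auto

lemma row_avg_dev_sq_le_coarse:
  assumes d: "1 \<le> d"
  shows "4 * row_avg d m (\<lambda>j. dev m j ^ 2) \<le> 2 ^ d * real m"
proof -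
  have "4 * row_avg d m (\<lambda>j. dev m j ^ 2) * 1 \<le> 4 * row_avg d m (\<lambda>j. dev m j ^ 2) * real d"
    using d row_avg_dev_sq_nonneg[of d m] by (intro mult_left_mono) auto
  then show ?thesis using row_avg_dev_sq_le[OF d, of m] by (simp add: mult_ac)
qed

text \<open>
  With weight $Y^2$ the increment on the right is $(Y+1)^3 - Y^3 \le 5Y^2 + 3$, whose average is
  already known to be $O(m)$.
\<close>

lemma row_avg_dev_fourth_le:
  assumes d: "1 \<le> d"
  shows "row_avg d m (\<lambda>j. dev m j ^ 4) \<le> 2 * 4 ^ d * (real m)\<^sup>2"
proof (cases "m = 0")
  case True
  then show ?thesis by (simp add: row_avg_def wavg_def dev_def)
next
  case False
  let ?E = "row_avg d m"
  have "4 * real d / real m * ?E (\<lambda>j. dev m j ^ 2 * dev m j ^ 2) \<le>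
        ?E (\<lambda>j. (1 - 2 * dev m j / real m) ^ d * (dev m (Suc j) ^ 2 * dev m (Suc j) - dev m j ^ 2 * dev m j))"
    using row_avg_weighted_second_moment[of d m "\<lambda>j. dev m j ^ 2"] d False by simp
  also have "\<dots> \<le> ?E (\<lambda>j. 2 ^ d * (5 * dev m j ^ 2 + 3))"
  proof (rule row_avg_mono)
    fix j assume j: "j \<in> {..m}"
    let ?y = "dev m j"
    have "dev m (Suc j) ^ 2 * dev m (Suc j) - ?y ^ 2 * ?y = 3 * ?y\<^sup>2 + 3 * ?y + 1"
      by (simp add: dev_def field_simps power2_eq_square)
    also have "\<dots> \<le> 5 * ?y\<^sup>2 + 3"
      using zero_le_power2[of "?y - 1"] zero_le_power2[of "?y"] unfolding power2_diff by (simp add: algebra_simps; linarith)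
    finally have le: "dev m (Suc j) ^ 2 * dev m (Suc j) - ?y ^ 2 * ?y \<le> 5 * ?y\<^sup>2 + 3" .
    have "(1 - 2 * ?y / real m) ^ d * (dev m (Suc j) ^ 2 * dev m (Suc j) - ?y ^ 2 * ?y) \<le>
          (1 - 2 * ?y / real m) ^ d * (5 * ?y\<^sup>2 + 3)"
      using j by (intro mult_left_mono le power_one_minus_bounds) auto
    also have "\<dots> \<le> 2 ^ d * (5 * ?y\<^sup>2 + 3)"
      using j by (intro mult_right_mono power_one_minus_bounds) auto
    finally show "(1 - 2 * ?y / real m) ^ d * (dev m (Suc j) ^ 2 * dev m (Suc j) - ?y ^ 2 * ?y) \<le>
          2 ^ d * (5 * ?y\<^sup>2 + 3)" .
  qed
  also have "\<dots> = 2 ^ d * (5 * ?E (\<lambda>j. dev m j ^ 2) + 3)"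
    by (simp only: row_avg_cmult row_avg_add row_avg_const)
  also have "\<dots> \<le> 2 ^ d * (5 * (2 ^ d * real m) + 3 * (2 ^ d * real m))"
  proof (intro mult_left_mono add_mono)
    show "?E (\<lambda>j. dev m j ^ 2) \<le> 2 ^ d * real m"
      using row_avg_dev_sq_le_coarse[OF d, of m] row_avg_dev_sq_nonneg[of d m] by linarith
    have "1 * 1 \<le> 2 ^ d * real m" using False by (intro mult_mono) auto
    then show "3 \<le> 3 * (2 ^ d * real m)" by simp
  qed auto
  also have "\<dots> = 8 * 4 ^ d * real m"
    by (simp add: power_mult_distrib[symmetric])
  finally have *: "4 * real d / real m * ?E (\<lambda>j. dev m j ^ 4) \<le> 8 * 4 ^ d * real m"
    by (simp add: power_add[symmetric])
  have "?E (\<lambda>j. dev m j ^ 4) * 1 \<le> ?E (\<lambda>j. dev m j ^ 4) * real d"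
    using d by (intro mult_left_mono row_avg_nonneg) auto
  with * False show ?thesis by (simp add: field_simps power2_eq_square)
qed

lemma row_avg_abs_dev_le:
  assumes d: "1 \<le> d"
  shows "row_avg d m (\<lambda>j. \<bar>dev m j\<bar>) \<le> 2 ^ d * sqrt (real m)"
proof (cases "m = 0")
  case True
  then show ?thesis by (simp add: row_avg_def wavg_def dev_def)
next
  case False
  define s where "s = sqrt (real m)"
  have s: "s > 0" "s * s = real m" using False by (auto simp: s_def)
  \<comment> \<open>$2s|y| \le y^2 + s^2$; the choice $s = \sqrt m$ balances the two terms\<close>
  have "row_avg d m (\<lambda>j. \<bar>dev m j\<bar>) \<le> row_avg d m (\<lambda>j. 1 / (2 * s) * dev m j ^ 2 + s / 2)"
  proof (rule row_avg_mono)
    fix j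
    show "\<bar>dev m j\<bar> \<le> 1 / (2 * s) * (dev m j)\<^sup>2 + s / 2"
      using zero_le_power2[of "\<bar>dev m j\<bar> - s"] s(1) unfolding power2_diff
      by (simp add: field_simps power2_eq_square)
  qed
  also have "\<dots> = 1 / (2 * s) * row_avg d m (\<lambda>j. dev m j ^ 2) + s / 2"
    by (simp only: row_avg_cmult row_avg_add row_avg_const)
  also have "\<dots> \<le> 1 / (2 * s) * (2 ^ d * (s * s)) + 2 ^ d * (s / 2)"
  proof (intro add_mono mult_left_mono)
    show "row_avg d m (\<lambda>j. dev m j ^ 2) \<le> 2 ^ d * (s * s)"
      using row_avg_dev_sq_le_coarse[OF d, of m] row_avg_dev_sq_nonneg[of d m] unfolding s(2) by linarith
    have "1 * (s / 2) \<le> 2 ^ d * (s / 2)" using s by (intro mult_right_mono) auto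
    then show "s / 2 \<le> 2 ^ d * (s / 2)" by simp
  qed (use s in auto)
  also have "\<dots> = 2 ^ d * s" using s(1) by (simp add: field_simps)
  finally show ?thesis by (simp add: s_def)
qed

text \<open>
  The Stein identity for $f = Y$ is the equality $E[Y((1+u)^d-(1-u)^d)] = E[(1-u)^d]$. Its left side is
  $4d\,E[Y^2]/m$ up to $O(m^{-3} E[Y^4]) = O(1/m)$, its right side is $1$ up to
  $O(E|u|) = O(m^{-1/2})$.
\<close>

lemma row_avg_dev_sq_asymp:
  assumes d: "1 \<le> d"
  shows "\<bar>4 * real d * row_avg d m (\<lambda>j. dev m j ^ 2) - real m\<bar> \<le> 18 * 16 ^ d * sqrt (real m)"
proof (cases "m = 0")
  case True
  then show ?thesis by (simp add: row_avg_def wavg_def dev_def)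
next
  case False
  let ?E = "row_avg d m"
  define u where "u = (\<lambda>j. 2 * dev m j / real m)"
  define s where "s = sqrt (real m)"
  have s: "s \<ge> 1" "s * s = real m" using False by (auto simp: s_def)
  have abs_u: "\<bar>u j\<bar> \<le> 1" if "j \<le> m" for j using abs_dev_le[OF that] by (simp add: u_def)
  have stein: "?E (\<lambda>j. dev m j * ((1 + u j) ^ d - (1 - u j) ^ d)) = ?E (\<lambda>j. (1 - u j) ^ d)"
  proof -
    have "?E (\<lambda>j. (1 + u j) ^ d * dev m j) = ?E (\<lambda>j. (1 - u j) ^ d * dev m (Suc j))"
      using row_avg_stein[of d m "dev m"] d False by (simp add: u_def)
    also have "\<dots> = ?E (\<lambda>j. (1 - u j) ^ d * dev m j) + ?E (\<lambda>j. (1 - u j) ^ d)"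
      by (simp add: row_avg_add[symmetric] dev_def algebra_simps)
    finally show ?thesis
      by (simp add: row_avg_diff right_diff_distrib mult.commute)
  qed
  have "\<bar>?E (\<lambda>j. dev m j * ((1 + u j) ^ d - (1 - u j) ^ d - 2 * real d * u j))\<bar> \<le>
        ?E (\<lambda>j. 4 ^ d * 8 / real m ^ 3 * dev m j ^ 4)"
    unfolding real_norm_def[symmetric]
  proof (rule norm_row_avg_le)
    fix j assume "j \<in> {..m}"
    then have "\<bar>dev m j\<bar> * \<bar>(1 + u j) ^ d - (1 - u j) ^ d - 2 * real d * u j\<bar> \<le> \<bar>dev m j\<bar> * (4 ^ d * \<bar>u j\<bar> ^ 3)"
      using binomial_odd_part_approx[of "u j" d] abs_u[of j] by (intro mult_left_mono) auto
    also have "\<dots> = 4 ^ d * 8 / real m ^ 3 * dev m j ^ 4"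
      by (simp add: u_def power_divide power_mult_distrib abs_mult eval_nat_numeral)
    finally show "norm (dev m j * ((1 + u j) ^ d - (1 - u j) ^ d - 2 * real d * u j)) \<le>
        4 ^ d * 8 / real m ^ 3 * dev m j ^ 4" by (simp add: abs_mult)
  qed
  also have "\<dots> = 4 ^ d * 8 / real m ^ 3 * ?E (\<lambda>j. dev m j ^ 4)" by (rule row_avg_cmult)
  also have "\<dots> \<le> 4 ^ d * 8 / real m ^ 3 * (2 * 4 ^ d * (real m)\<^sup>2)"
    by (intro mult_left_mono row_avg_dev_fourth_le d) auto
  also have "\<dots> = 16 * 16 ^ d / real m"
  proof -
    have "(4::real) ^ d * 4 ^ d = 16 ^ d" by (simp flip: power_mult_distrib)
    then show ?thesis using False by (simp add: field_simps eval_nat_numeral)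
  qed
  also have "\<dots> \<le> 16 * 16 ^ d / s"
  proof -
    have "s * 1 \<le> real m" unfolding s(2)[symmetric] using s(1) by (intro mult_left_mono) auto
    then show ?thesis using s by (intro divide_left_mono) auto
  qed
  finally have err1: "\<bar>?E (\<lambda>j. dev m j * ((1 + u j) ^ d - (1 - u j) ^ d - 2 * real d * u j))\<bar> \<le> 16 * 16 ^ d / s" .
  have "\<bar>?E (\<lambda>j. (1 - u j) ^ d - 1)\<bar> \<le> ?E (\<lambda>j. 2 ^ d * 2 / real m * \<bar>dev m j\<bar>)"
    unfolding real_norm_def[symmetric]
  proof (rule norm_row_avg_le)
    fix j assume "j \<in> {..m}"
    then have "\<bar>(1 - u j) ^ d - 1\<bar> \<le> (2 ^ d - 1) * \<bar>u j\<bar>"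
      using power_one_minus_approx[of "u j" d] abs_u[of j] by auto
    also have "\<dots> \<le> 2 ^ d * \<bar>u j\<bar>" by (intro mult_right_mono) auto
    finally show "norm ((1 - u j) ^ d - 1) \<le> 2 ^ d * 2 / real m * norm (dev m j)"
      by (simp add: u_def abs_mult)
  qed
  also have "\<dots> = 2 ^ d * 2 / real m * ?E (\<lambda>j. \<bar>dev m j\<bar>)" by (rule row_avg_cmult)
  also have "\<dots> \<le> 2 ^ d * 2 / real m * (2 ^ d * s)"
    unfolding s_def by (intro mult_left_mono row_avg_abs_dev_le d) auto
  also have "\<dots> = 2 * 4 ^ d / s"
  proof -
    have "(2::real) ^ d * 2 ^ d = 4 ^ d" by (simp flip: power_mult_distrib)
    then show ?thesis using s(1) unfolding s(2)[symmetric] by (simp add: field_simps)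
  qed
  also have "\<dots> \<le> 2 * 16 ^ d / s"
    using s(1) by (intro divide_right_mono mult_left_mono power_mono) auto
  finally have err2: "\<bar>?E (\<lambda>j. (1 - u j) ^ d) - 1\<bar> \<le> 2 * 16 ^ d / s"
    by (simp add: row_avg_diff row_avg_const)
  have "?E (\<lambda>j. dev m j * ((1 + u j) ^ d - (1 - u j) ^ d - 2 * real d * u j)) =
        ?E (\<lambda>j. (1 - u j) ^ d) - 4 * real d / real m * ?E (\<lambda>j. dev m j ^ 2)"
    unfolding stein[symmetric] row_avg_cmult[symmetric] row_avg_diff[symmetric]
    by (simp add: u_def power2_eq_square algebra_simps)
  then have "\<bar>4 * real d / real m * ?E (\<lambda>j. dev m j ^ 2) - 1\<bar> \<le> 18 * 16 ^ d / s"
    using abs_triangle_ineq4[of "?E (\<lambda>j. (1 - u j) ^ d) - 1"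
        "?E (\<lambda>j. dev m j * ((1 + u j) ^ d - (1 - u j) ^ d - 2 * real d * u j))"] err1 err2
    by (simp add: add_divide_distrib[symmetric])
  then have "real m * \<bar>4 * real d / real m * ?E (\<lambda>j. dev m j ^ 2) - 1\<bar> \<le> real m * (18 * 16 ^ d / s)"
    by (intro mult_left_mono) auto
  moreover have "real m * (18 * 16 ^ d / s) = 18 * 16 ^ d * s"
    using s(1) unfolding s(2)[symmetric] by simp
  moreover have "real m * \<bar>4 * real d / real m * ?E (\<lambda>j. dev m j ^ 2) - 1\<bar> =
      \<bar>4 * real d * ?E (\<lambda>j. dev m j ^ 2) - real m\<bar>"
    using False by (simp add: abs_mult_pos' right_diff_distrib)
  ultimately show ?thesis by (simp add: s_def)
qed

section \<open>The central limit theorem for a single row\<close>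

text \<open>
  The spacing of the lattice of values of the standardised variable: the inverse of the
  asymptotic standard deviation $\sqrt{m/(4d)}$ of the row. For \<open>m = 0\<close> it is \<open>0\<close>, which suits the
  degenerate row.
\<close>

definition row_step :: "nat \<Rightarrow> nat \<Rightarrow> real" where
  "row_step d m = 2 * sqrt (real d / real m)"

definition row_char :: "nat \<Rightarrow> nat \<Rightarrow> real \<Rightarrow> complex" where
  "row_char d m t = row_avg d m (\<lambda>j. iexp (t * (row_step d m * dev m j)))"

lemma row_step_nonneg: "0 \<le> row_step d m"
  by (simp add: row_step_def)

lemma row_step_tendsto_0: "row_step d \<longlonglongrightarrow> 0"
proof -
  have "(\<lambda>m. 2 * sqrt (real d / real m)) \<longlonglongrightarrow> 2 * sqrt 0"
    by (intro tendsto_intros lim_const_over_n)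
  then show ?thesis by (simp add: row_step_def[abs_def])
qed

lemma row_avg_std_sq_le:
  assumes d: "1 \<le> d"
  shows "row_avg d m (\<lambda>j. (row_step d m * dev m j)\<^sup>2) \<le> 2 ^ d"
proof -
  have "row_avg d m (\<lambda>j. (row_step d m * dev m j)\<^sup>2) = row_step d m ^ 2 * row_avg d m (\<lambda>j. (dev m j)\<^sup>2)"
    by (simp only: power_mult_distrib row_avg_cmult)
  also have "\<dots> = (4 * real d * row_avg d m (\<lambda>j. (dev m j)\<^sup>2)) / real m"
    by (simp add: row_step_def power_mult_distrib)
  also have "\<dots> \<le> 2 ^ d"
    using row_avg_dev_sq_le[OF d, of m] by (cases "m = 0") (auto simp: field_simps)
  finally show ?thesis .
qed

lemma row_avg_abs_std_le:
  assumes d: "1 \<le> d"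
  shows "row_avg d m (\<lambda>j. \<bar>row_step d m * dev m j\<bar>) \<le> 2 ^ d"
proof -
  let ?z = "\<lambda>j. row_step d m * dev m j"
  have "row_avg d m (\<lambda>j. \<bar>?z j\<bar>) \<le> row_avg d m (\<lambda>j. 1 / 2 * (?z j)\<^sup>2 + 1 / 2)"
  proof (rule row_avg_mono)
    fix j show "\<bar>?z j\<bar> \<le> 1 / 2 * (?z j)\<^sup>2 + 1 / 2"
      using zero_le_power2[of "\<bar>?z j\<bar> - 1"] unfolding power2_diff by simp
  qed
  also have "\<dots> = 1 / 2 * row_avg d m (\<lambda>j. (?z j)\<^sup>2) + 1 / 2"
    by (simp only: row_avg_cmult row_avg_add row_avg_const)
  also have "\<dots> \<le> 1 / 2 * 2 ^ d + 1 / 2 * 2 ^ d"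
    using row_avg_std_sq_le[OF d, of m] one_le_power[of "2::real" d] by (intro add_mono mult_left_mono) auto
  finally show ?thesis by simp
qed

lemma row_char_has_derivative:
  "(row_char d m has_vector_derivative
     row_avg d m (\<lambda>j. \<i> * of_real (row_step d m * dev m j) * iexp (t * (row_step d m * dev m j)))) (at t)"
  unfolding row_char_def[abs_def] row_avg_def
proof (rule has_vector_derivative_wavg)
  fix j
  let ?z = "row_step d m * dev m j"
  have "((\<lambda>t. exp ((\<i> * of_real ?z) * of_real t)) has_vector_derivative
      (\<i> * of_real ?z) * exp ((\<i> * of_real ?z) * of_real t)) (at t)"
    by (rule has_vector_derivative_real_field) (auto intro!: derivative_eq_intros)
  then show "((\<lambda>t. iexp (t * ?z)) has_vector_derivative \<i> * of_real ?z * iexp (t * ?z)) (at t)"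
    by (simp add: mult_ac)
qed

text \<open>
  The finite difference quotient of $e^{itx}$ over one lattice step, compared with its derivative.
\<close>

lemma iexp_linear_error:
  assumes "0 < h"
  shows "norm (\<i> / of_real h * (iexp (t * h) - 1) + of_real t) \<le> t\<^sup>2 * h / 2"
proof -
  have "\<i> / of_real h * (iexp (t * h) - 1) + of_real t =
        \<i> / of_real h * (iexp (t * h) - (\<Sum>k\<le>1. (\<i> * of_real (t * h)) ^ k / fact k))"
    using assms by (simp add: field_simps)
  then have "norm (\<i> / of_real h * (iexp (t * h) - 1) + of_real t) =
        norm (iexp (t * h) - (\<Sum>k\<le>1. (\<i> * of_real (t * h)) ^ k / fact k)) / h"
    using assms by (simp add: norm_mult norm_divide)
  also have "\<dots> \<le> (\<bar>t * h\<bar> ^ Suc 1 / fact (Suc 1)) / h"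
    using assms by (intro divide_right_mono iexp_approx1) auto
  also have "\<dots> = t\<^sup>2 * h / 2"
    using assms by (simp add: power2_eq_square abs_mult)
  finally show ?thesis .
qed

text \<open>
  The Stein identity for $e^{itZ}$. One step of $J$ multiplies $e^{itZ}$ by $e^{ith}$, where $h$ is
  the step, and $2du = hZ$; hence $h\,E[Z e^{itZ}] \approx E[((1+u)^d - (1-u)^d) e^{itZ}] =
  (e^{ith}-1)\,E[(1-u)^d e^{itZ}] \approx ith\,\varphi$. The three approximations leave the errors
  \<open>p\<close>, \<open>r\<close> and \<open>q\<close> of the proof, each contributing $O(h)$ to $\varphi' + t\varphi$.
\<close>

lemma row_char_ode:
  assumes d: "1 \<le> d" and m: "1 \<le> m"
  shows "norm (row_avg d m (\<lambda>j. \<i> * of_real (row_step d m * dev m j) * iexp (t * (row_step d m * dev m j)))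
            + of_real t * row_char d m t) \<le> 3 * 8 ^ d * row_step d m * (1 + \<bar>t\<bar>)\<^sup>2"
proof -
  let ?E = "row_avg d m"
  define h where "h = row_step d m"
  define z where "z = (\<lambda>j. h * dev m j)"
  define u where "u = (\<lambda>j. 2 * dev m j / real m)"
  define e where "e = (\<lambda>j. iexp (t * z j))"
  define D where "D = (\<lambda>j. (1 + u j) ^ d - (1 - u j) ^ d)"
  define \<phi> where "\<phi> = row_char d m t"
  have u: "u j = 2 * dev m j / real m" for j by (simp add: u_def)
  have h: "h > 0" using d m by (simp add: h_def row_step_def)
  have h2: "h * h = 4 * real d / real m"
    using d m by (simp add: h_def row_step_def mult_ac power2_eq_square[symmetric] power_mult_distrib)
  have uz: "2 * real d * u j = h * z j" for j
    using h2 by (simp add: u_def z_def mult.assoc[symmetric])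
  have u_le: "\<bar>u j\<bar> \<le> h * \<bar>z j\<bar>" for j
  proof -
    have "\<bar>u j\<bar> * 1 \<le> \<bar>u j\<bar> * (2 * real d)" using d by (intro mult_left_mono) auto
    also have "\<dots> = \<bar>2 * real d * u j\<bar>" by (simp add: abs_mult)
    also have "\<dots> = h * \<bar>z j\<bar>" using h by (simp add: uz abs_mult)
    finally show ?thesis by simp
  qed
  have abs_u: "\<bar>u j\<bar> \<le> 1" if "j \<le> m" for j using abs_dev_le[OF that] by (simp add: u_def)
  have norm_e [simp]: "norm (e j) = 1" for j by (simp add: e_def)
  have \<phi>: "\<phi> = ?E e" by (simp add: \<phi>_def row_char_def e_def z_def h_def)
  have eSuc: "iexp (t * z (Suc j)) = iexp (t * h) * e j" for j
    by (simp add: e_def z_def dev_def algebra_simps flip: exp_add)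
  define q where "q = ?E (\<lambda>j. of_real ((1 - u j) ^ d) * e j) - \<phi>"
  define r where "r = \<i> / of_real h * (iexp (t * h) - 1) + of_real t"
  define p where "p = ?E (\<lambda>j. of_real (D j - 2 * real d * u j) * e j)"
  have stein: "?E (\<lambda>j. of_real (D j) * e j) = (iexp (t * h) - 1) * (\<phi> + q)"
  proof -
    have "?E (\<lambda>j. of_real ((1 + u j) ^ d) * e j) = ?E (\<lambda>j. iexp (t * h) * (of_real ((1 - u j) ^ d) * e j))"
      using row_avg_stein[OF d m, of "\<lambda>j. iexp (t * z j)"] unfolding eSuc u[symmetric]
      by (simp add: e_def scaleR_conv_of_real mult_ac)
    also have "\<dots> = iexp (t * h) * (\<phi> + q)"
      unfolding row_avg_cmult by (simp add: q_def)
    finally show ?thesis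
      by (simp add: D_def left_diff_distrib row_avg_diff q_def)
  qed
  have "?E (\<lambda>j. \<i> * of_real (z j) * e j) = \<i> / of_real h * ?E (\<lambda>j. of_real (h * z j) * e j)"
    unfolding row_avg_cmult[symmetric] using h by (intro row_avg_cong) simp
  also have "?E (\<lambda>j. of_real (h * z j) * e j) = ?E (\<lambda>j. of_real (D j) * e j) - p"
    by (simp add: p_def uz[symmetric] left_diff_distrib row_avg_diff)
  also have "\<i> / of_real h * (?E (\<lambda>j. of_real (D j) * e j) - p) + of_real t * \<phi> =
      r * (\<phi> + q) - of_real t * q - \<i> / of_real h * p"
    unfolding stein r_def by (simp add: algebra_simps add_divide_distrib diff_divide_distrib)
  finally have "norm (?E (\<lambda>j. \<i> * of_real (z j) * e j) + of_real t * \<phi>) \<le>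
      norm r * norm (\<phi> + q) + \<bar>t\<bar> * norm q + norm p / h"
    using norm_triangle_ineq4[of "r * (\<phi> + q) - of_real t * q" "\<i> / of_real h * p"]
      norm_triangle_ineq4[of "r * (\<phi> + q)" "of_real t * q"] h
    by (simp add: norm_mult norm_divide)
  also have "\<dots> \<le> (t\<^sup>2 * h / 2) * 2 ^ d + \<bar>t\<bar> * (4 ^ d * h) + 8 ^ d * h\<^sup>2 / h"
  proof (intro add_mono mult_mono divide_right_mono)
    show "norm r \<le> t\<^sup>2 * h / 2" unfolding r_def by (rule iexp_linear_error[OF h])
    have "norm (?E (\<lambda>j. of_real ((1 - u j) ^ d) * e j)) \<le> ?E (\<lambda>_. 2 ^ d)"
      using power_one_minus_bounds[where m = m and d = d]
      by (intro norm_row_avg_le) (auto simp: norm_mult u_def norm_power simp flip: of_real_power)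
    then show "norm (\<phi> + q) \<le> 2 ^ d" by (simp add: q_def row_avg_const)
    have "norm q = norm (?E (\<lambda>j. of_real ((1 - u j) ^ d - 1) * e j))"
      by (simp add: q_def \<phi> row_avg_diff left_diff_distrib)
    also have "\<dots> \<le> ?E (\<lambda>j. 2 ^ d * h * \<bar>z j\<bar>)"
    proof (rule norm_row_avg_le)
      fix j assume "j \<in> {..m}"
      then have "\<bar>(1 - u j) ^ d - 1\<bar> \<le> (2 ^ d - 1) * \<bar>u j\<bar>"
        using power_one_minus_approx[of "u j" d] abs_u[of j] by auto
      also have "\<dots> \<le> 2 ^ d * (h * \<bar>z j\<bar>)" using u_le[of j] by (intro mult_mono) auto
      finally show "norm (of_real ((1 - u j) ^ d - 1) * e j) \<le> 2 ^ d * h * \<bar>z j\<bar>"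
        unfolding norm_mult norm_e norm_of_real by (simp add: mult_ac)
    qed
    also have "\<dots> \<le> 2 ^ d * h * 2 ^ d"
      unfolding row_avg_cmult using row_avg_abs_std_le[OF d, of m] h
      by (intro mult_left_mono) (auto simp: z_def h_def)
    also have "\<dots> = 4 ^ d * h" by (simp add: mult_ac flip: power_mult_distrib)
    finally show "norm q \<le> 4 ^ d * h" .
    have "norm p \<le> ?E (\<lambda>j. 4 ^ d * h\<^sup>2 * (z j)\<^sup>2)"
      unfolding p_def
    proof (rule norm_row_avg_le)
      fix j assume "j \<in> {..m}"
      then have j: "\<bar>u j\<bar> \<le> 1" using abs_u by simp
      have "\<bar>D j - 2 * real d * u j\<bar> \<le> 4 ^ d * \<bar>u j\<bar> ^ 3"
        using binomial_odd_part_approx[OF j, of d] by (simp add: D_def)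
      also have "\<dots> \<le> 4 ^ d * \<bar>u j\<bar> ^ 2"
        using j by (intro mult_left_mono power_decreasing) auto
      also have "\<dots> \<le> 4 ^ d * (h * \<bar>z j\<bar>) ^ 2"
        using u_le[of j] by (intro mult_left_mono power_mono) auto
      finally show "norm (of_real (D j - 2 * real d * u j) * e j) \<le> 4 ^ d * h\<^sup>2 * (z j)\<^sup>2"
        unfolding norm_mult norm_e norm_of_real by (simp add: power_mult_distrib mult_ac)
    qed
    also have "\<dots> \<le> 4 ^ d * h\<^sup>2 * 2 ^ d"
      unfolding row_avg_cmult using row_avg_std_sq_le[OF d, of m]
      by (intro mult_left_mono) (auto simp: z_def h_def)
    also have "\<dots> = 8 ^ d * h\<^sup>2" by (simp add: mult_ac flip: power_mult_distrib)
    finally show "norm p \<le> 8 ^ d * h\<^sup>2" .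
  qed (use h in auto)
  also have "\<dots> \<le> 3 * 8 ^ d * h * (1 + \<bar>t\<bar>)\<^sup>2"
  proof -
    have "(t\<^sup>2 * h / 2) * 2 ^ d \<le> (t\<^sup>2 * h) * 8 ^ d"
      using h by (intro mult_mono power_mono) auto
    moreover have "\<bar>t\<bar> * (4 ^ d * h) \<le> \<bar>t\<bar> * (8 ^ d * h)"
      using h by (intro mult_left_mono mult_right_mono power_mono) auto
    moreover have "8 ^ d * h\<^sup>2 / h = 8 ^ d * h" by (simp add: power2_eq_square)
    ultimately have "(t\<^sup>2 * h / 2) * 2 ^ d + \<bar>t\<bar> * (4 ^ d * h) + 8 ^ d * h\<^sup>2 / h \<le>
        8 ^ d * h * (t\<^sup>2 + \<bar>t\<bar> + 1)" by (simp add: algebra_simps)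
    also have "\<dots> \<le> 8 ^ d * h * (3 * (1 + \<bar>t\<bar>)\<^sup>2)"
      using h by (intro mult_left_mono) (auto simp: power2_eq_square algebra_simps abs_mult_self_eq)
    finally show ?thesis by (simp add: mult_ac)
  qed
  finally show ?thesis by (simp add: z_def e_def h_def \<phi>_def)
qed

text \<open>
  The function $e^{s^2/2} f(s)$ equals $1$ at $0$ and has derivative
  $e^{s^2/2}(f'(s) + s f(s))$, so the mean value inequality applies.
\<close>

lemma gronwall_gaussian:
  fixes f f' :: "real \<Rightarrow> complex"
  assumes deriv: "\<And>s. (f has_vector_derivative f' s) (at s)" and f0: "f 0 = 1"
    and bound: "\<And>s. \<bar>s\<bar> \<le> \<bar>t\<bar> \<Longrightarrow> norm (f' s + of_real s * f s) \<le> B"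
  shows "norm (f t - of_real (exp (- (t\<^sup>2) / 2))) \<le> B * exp (t\<^sup>2 / 2) * \<bar>t\<bar>"
proof -
  define g where "g = (\<lambda>s. exp (s\<^sup>2 / 2) *\<^sub>R f s)"
  have g: "(g has_vector_derivative exp (s\<^sup>2 / 2) *\<^sub>R (f' s + of_real s * f s)) (at s within S)" for s S
    unfolding g_def
    by (rule has_vector_derivative_at_within)
       (auto intro!: derivative_eq_intros deriv simp: scaleR_conv_of_real algebra_simps)
  have "norm (g t - g 0) \<le> (exp (t\<^sup>2 / 2) * B) * norm (t - 0)"
  proof (rule differentiable_bound[where S = "closed_segment 0 t" and f' = "\<lambda>s x. x *\<^sub>R (exp (s\<^sup>2 / 2) *\<^sub>R (f' s + of_real s * f s))"])
    fix s assume "s \<in> closed_segment 0 t"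
    then have s: "\<bar>s\<bar> \<le> \<bar>t\<bar>" by (auto simp: closed_segment_eq_real_ivl split: if_splits)
    show "(g has_derivative (\<lambda>x. x *\<^sub>R (exp (s\<^sup>2 / 2) *\<^sub>R (f' s + of_real s * f s)))) (at s within closed_segment 0 t)"
      using g unfolding has_vector_derivative_def .
    have "onorm (\<lambda>x. x *\<^sub>R (exp (s\<^sup>2 / 2) *\<^sub>R (f' s + of_real s * f s))) \<le> norm (exp (s\<^sup>2 / 2) *\<^sub>R (f' s + of_real s * f s))"
      by (rule onorm_le) (simp add: abs_mult mult_ac)
    also have "\<dots> \<le> exp (t\<^sup>2 / 2) * B"
      unfolding norm_scaleR using s bound[OF s]
      by (intro mult_mono) (auto simp: abs_le_square_iff)
    finally show "onorm (\<lambda>x. x *\<^sub>R (exp (s\<^sup>2 / 2) *\<^sub>R (f' s + of_real s * f s))) \<le> exp (t\<^sup>2 / 2) * B" .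
  qed auto
  then have *: "norm (exp (t\<^sup>2 / 2) *\<^sub>R f t - 1) \<le> B * exp (t\<^sup>2 / 2) * \<bar>t\<bar>"
    by (simp add: g_def f0 mult_ac)
  have "f t - of_real (exp (- (t\<^sup>2) / 2)) = exp (- (t\<^sup>2) / 2) *\<^sub>R (exp (t\<^sup>2 / 2) *\<^sub>R f t - 1)"
    by (simp add: scaleR_conv_of_real exp_minus field_simps)
  then have "norm (f t - of_real (exp (- (t\<^sup>2) / 2))) = exp (- (t\<^sup>2) / 2) * norm (exp (t\<^sup>2 / 2) *\<^sub>R f t - 1)"
    by simp
  also have "\<dots> \<le> 1 * norm (exp (t\<^sup>2 / 2) *\<^sub>R f t - 1)" by (intro mult_right_mono) auto
  finally show ?thesis using * by simp
qed

text \<open>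
  The central limit theorem for the probabilities proportional to $\binom{m}{j}^d$, $j \le m$: on the
  fixed interval between $0$ and $t$ the defect in the Gaussian differential equation is of the order
  of \<open>row_step\<close>, hence tends to $0$.
\<close>

theorem row_char_tendsto:
  assumes d: "1 \<le> d"
  shows "(\<lambda>m. row_char d m t) \<longlonglongrightarrow> of_real (exp (- (t\<^sup>2) / 2))"
proof (rule LIM_zero_cancel, rule Lim_null_comparison)
  show "\<forall>\<^sub>F m in sequentially. norm (row_char d m t - of_real (exp (- (t\<^sup>2) / 2))) \<le>
      3 * 8 ^ d * row_step d m * (1 + \<bar>t\<bar>)\<^sup>2 * exp (t\<^sup>2 / 2) * \<bar>t\<bar>"
    using eventually_ge_at_top[of 1]
  proof eventually_elim
    case (elim m)
    show ?case
    proof (rule gronwall_gaussian[OF row_char_has_derivative])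
      show "row_char d m 0 = 1" by (simp add: row_char_def row_avg_const)
      fix s :: real assume s: "\<bar>s\<bar> \<le> \<bar>t\<bar>"
      have "3 * 8 ^ d * row_step d m * (1 + \<bar>s\<bar>)\<^sup>2 \<le> 3 * 8 ^ d * row_step d m * (1 + \<bar>t\<bar>)\<^sup>2"
        using s by (intro mult_left_mono power_mono) (auto simp: row_step_nonneg)
      then show "norm (row_avg d m (\<lambda>j. \<i> * of_real (row_step d m * dev m j) * iexp (s * (row_step d m * dev m j)))
            + of_real s * row_char d m s) \<le> 3 * 8 ^ d * row_step d m * (1 + \<bar>t\<bar>)\<^sup>2"
        using row_char_ode[OF d elim, of s] by linarith
    qed
  qed
  show "(\<lambda>m. 3 * 8 ^ d * row_step d m * (1 + \<bar>t\<bar>)\<^sup>2 * exp (t\<^sup>2 / 2) * \<bar>t\<bar>) \<longlonglongrightarrow> 0"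
    by (intro tendsto_mult_left_zero tendsto_mult_right_zero row_step_tendsto_0)
qed

section \<open>Mixing the rows\<close>

definition row_total :: "nat \<Rightarrow> nat \<Rightarrow> real" where
  "row_total d m = (\<Sum>j\<le>m. real (m choose j) ^ d)"

lemma row_total_pos: "0 < row_total d m"
  using weights_row[of m d] by (simp add: weights_def row_total_def)

lemma row_total_ge_1: "1 \<le> row_total d m"
  unfolding row_total_def using member_le_sum[of 0 "{..m}" "\<lambda>j. real (m choose j) ^ d"] by simp

lemma power_superadditive:
  fixes a b :: real
  assumes "0 \<le> a" "0 \<le> b" "1 \<le> d"
  shows "a ^ d + b ^ d \<le> (a + b) ^ d"
  using assms(3)
proof (induction d rule: dec_induct)
  case (step d)
  have "a ^ Suc d + b ^ Suc d \<le> (a + b) * (a ^ d + b ^ d)"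
    using assms(1,2) by (simp add: algebra_simps)
  also have "\<dots> \<le> (a + b) * (a + b) ^ d"
    using assms(1,2) step.IH by (intro mult_left_mono) auto
  finally show ?case by simp
qed simp

text \<open>
  Pascal's rule and superadditivity of $x \mapsto x^d$: every entry of row \<open>m\<close> contributes to
  two entries of the next row.
\<close>

lemma row_total_double:
  assumes "1 \<le> d"
  shows "2 * row_total d m \<le> row_total d (Suc m)"
proof -
  let ?c = "\<lambda>m j. real (m choose j) ^ d"
  have "row_total d m = (\<Sum>j\<le>Suc m. ?c m j)"
    using assms by (simp add: row_total_def)
  also have "\<dots> = 1 + (\<Sum>j\<le>m. ?c m (Suc j))"
    by (simp only: sum.atMost_Suc_shift) simp
  finally have "2 * row_total d m = 1 + (\<Sum>j\<le>m. ?c m j + ?c m (Suc j))"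
    unfolding sum.distrib by (simp add: row_total_def)
  also have "\<dots> \<le> 1 + (\<Sum>j\<le>m. ?c (Suc m) (Suc j))"
    using power_superadditive[OF of_nat_0_le_iff of_nat_0_le_iff assms]
    by (intro add_left_mono sum_mono) simp
  also have "\<dots> = row_total d (Suc m)"
    unfolding row_total_def by (simp only: sum.atMost_Suc_shift) simp
  finally show ?thesis .
qed

text \<open>
  The law of $M$: the starting point of a random path, less one.
\<close>

definition len_avg :: "nat \<Rightarrow> nat \<Rightarrow> (nat \<Rightarrow> 'b::real_vector) \<Rightarrow> 'b" where
  "len_avg d n = wavg {..<n} (row_total d)"

lemma weights_len: "1 \<le> n \<Longrightarrow> weights {..<n} (row_total d)"
  unfolding weights_def using row_total_pos[of d]
  by (auto intro!: sum_pos less_imp_le simp: lessThan_empty_iff)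

lemmas len_avg_add = wavg_add[where I = "{..<n}" and w = "row_total d" for n d, folded len_avg_def]
lemmas len_avg_diff = wavg_diff[where I = "{..<n}" and w = "row_total d" for n d, folded len_avg_def]
lemmas len_avg_cmult = wavg_cmult[where I = "{..<n}" and w = "row_total d" for n d, folded len_avg_def]
lemmas len_avg_const = wavg_const[OF weights_len, folded len_avg_def]
lemmas len_avg_mono = wavg_mono[OF weights_len, folded len_avg_def]
lemmas len_avg_nonneg = wavg_nonneg[OF weights_len, folded len_avg_def]
lemmas norm_len_avg_le = norm_wavg_le[OF weights_len, folded len_avg_def]

text \<open>
  A Toeplitz argument: the total weight diverges, so any finite number of rows is negligible.
\<close>

lemma len_avg_tendsto:
  fixes g :: "nat \<Rightarrow> 'b::real_normed_vector"
  assumes "g \<longlonglongrightarrow> L"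
  shows "(\<lambda>n. len_avg d n g) \<longlonglongrightarrow> L"
proof -
  define S where "S = (\<lambda>n. \<Sum>m<n. row_total d m)"
  have S_ge: "real n \<le> S n" for n
    unfolding S_def using sum_mono[of "{..<n}" "\<lambda>_. 1" "row_total d"] row_total_ge_1 by simp
  have S_lim: "filterlim S at_top sequentially"
    by (rule filterlim_at_top_mono[OF filterlim_real_sequentially]) (simp add: S_ge)
  have "Bseq (\<lambda>m. g m - L)" using assms by (intro convergent_imp_Bseq convergent_diff) (auto simp: convergent_def)
  then obtain B where B: "B > 0" "\<And>m. norm (g m - L) \<le> B" by (auto elim: BseqE)
  have "(\<lambda>n. len_avg d n g - L) \<longlonglongrightarrow> 0"
  proof (rule LIMSEQ_I)
    fix r :: real assume r: "0 < r"
    obtain N where N: "\<And>m. m \<ge> N \<Longrightarrow> norm (g m - L) < r / 2"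
      using LIMSEQ_D[OF assms, of "r/2"] r by auto
    have "((\<lambda>n. B * S N / S n) \<longlongrightarrow> 0) sequentially"
      by (intro tendsto_divide_0[OF tendsto_const] filterlim_at_top_imp_at_infinity S_lim)
    then have "\<forall>\<^sub>F n in sequentially. B * S N / S n < r / 2"
      using r by (intro order_tendstoD) auto
    then obtain N' where N': "\<And>n. n \<ge> N' \<Longrightarrow> B * S N / S n < r / 2"
      by (auto simp: eventually_sequentially)
    show "\<exists>no. \<forall>n\<ge>no. norm (len_avg d n g - L - 0) < r"
    proof (intro exI allI impI)
      fix n assume n: "n \<ge> max (Suc N) N'"
      then have n1: "1 \<le> n" by simp
      have Sn: "0 < S n" using S_ge[of n] n1 by linarith
      have "len_avg d n g - L = wavg {..<n} (row_total d) (\<lambda>m. g m - L)"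
        by (simp add: len_avg_def wavg_diff wavg_const[OF weights_len[OF n1]])
      also have "norm \<dots> \<le> wavg {..<n} (row_total d) (\<lambda>m. (if m < N then B else 0) + r / 2)"
      proof (rule norm_wavg_le[OF weights_len[OF n1]])
        fix m show "norm (g m - L) \<le> (if m < N then B else 0) + r / 2"
          using B(2)[of m] N[of m] r by (cases "m < N") auto
      qed
      also have "\<dots> = wavg {..<n} (row_total d) (\<lambda>m. if m < N then B else 0) + r / 2"
        by (simp only: wavg_add wavg_const[OF weights_len[OF n1]])
      also have "wavg {..<n} (row_total d) (\<lambda>m. if m < N then B else 0) = B * S N / S n"
      proof -
        have "(\<Sum>m<n. row_total d m * (if m < N then B else 0)) = (\<Sum>m<N. row_total d m * B)"
          using n by (intro sum.mono_neutral_cong_right) auto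
        then show ?thesis
          by (simp add: wavg_def S_def sum_distrib_left sum_distrib_right sum_divide_distrib field_simps)
      qed
      also have "B * S N / S n + r / 2 < r" using N'[of n] n by linarith
      finally show "norm (len_avg d n g - L - 0) < r" by simp
    qed
  qed
  then show ?thesis by (rule LIM_zero_cancel)
qed

lemma sum_gap_sq_Suc:
  fixes a :: "nat \<Rightarrow> real"
  shows "(\<Sum>m<Suc n. a m * (real (Suc n) - real m)\<^sup>2) =
    (\<Sum>m<n. a m * (real n - real m)\<^sup>2) + 2 * (\<Sum>m<n. a m * (real n - real m)) + (\<Sum>m<n. a m) + a n"
  unfolding sum_distrib_left by (simp add: sum.distrib[symmetric] algebra_simps power2_eq_square)

text \<open>
  Passing from \<open>n\<close> to \<open>n + 1\<close> raises each gap by one, so each sum on the left grows by a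
  combination of the lower sums and the total of row \<open>n\<close>, while the row total at least doubles. The
  constants 1, 2, 6 are the fixed points of this recursion.
\<close>

lemma row_total_gap_moments:
  assumes "1 \<le> d"
  shows "(\<Sum>m<n. row_total d m) \<le> row_total d n"
    and "(\<Sum>m<n. row_total d m * (real n - real m)) \<le> 2 * row_total d n"
    and "(\<Sum>m<n. row_total d m * (real n - real m)\<^sup>2) \<le> 6 * row_total d n"
proof (induction n)
  case 0
  { case 1 show ?case using row_total_pos[of d 0] by simp }
  { case 2 show ?case using row_total_pos[of d 0] by simp }
  { case 3 show ?case using row_total_pos[of d 0] by simp }
next
  case (Suc n)
  let ?A = "row_total d"
  note dbl = row_total_double[OF assms, of n]
  { case 1 show ?case using Suc.IH(1) dbl by simp }
  { case 2
    have "(\<Sum>m<Suc n. ?A m * (real (Suc n) - real m)) =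
        (\<Sum>m<n. ?A m * (real n - real m)) + (\<Sum>m<n. ?A m) + ?A n"
      by (simp add: sum.distrib[symmetric] algebra_simps)
    then show ?case using Suc.IH(1,2) dbl by simp }
  { case 3
    show ?case using Suc.IH dbl sum_gap_sq_Suc[of ?A n] by simp }
qed

lemma len_avg_gap_sq_le:
  assumes "1 \<le> d" "1 \<le> n"
  shows "len_avg d n (\<lambda>m. (real n - real m)\<^sup>2) \<le> 12"
proof -
  obtain k where n: "n = Suc k" using assms(2) by (cases n) auto
  let ?A = "row_total d"
  have S: "0 < (\<Sum>m<n. ?A m)" using weights_len[OF assms(2)] by (simp add: weights_def)
  have "(\<Sum>m<n. ?A m * (real n - real m)\<^sup>2) \<le> 12 * ?A k"
  using row_total_gap_moments[OF assms(1), of k] unfolding n sum_gap_sq_Suc by simp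
  also have "\<dots> \<le> 12 * (\<Sum>m<n. ?A m)"
    using row_total_pos[of d] unfolding n by (simp add: sum_nonneg less_imp_le)
  finally show ?thesis using S by (simp add: len_avg_def wavg_def field_simps)
qed

section \<open>The central limit theorem for the whole triangle\<close>

text \<open>
  The law of the pair $(M,J)$ on the triangle of all rows below \<open>n\<close>.
\<close>

definition tri_avg :: "nat \<Rightarrow> nat \<Rightarrow> (nat \<times> nat \<Rightarrow> 'b::real_vector) \<Rightarrow> 'b" where
  "tri_avg d n = wavg (Sigma {..<n} (\<lambda>m. {..m})) (\<lambda>(m, j). real (m choose j) ^ d)"

lemma tri_avg_eq: "tri_avg d n f = len_avg d n (\<lambda>m. row_avg d m (\<lambda>j. f (m, j)))"
  unfolding tri_avg_def len_avg_def row_avg_def row_total_def[abs_def]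
  by (rule wavg_Sigma) (auto intro: weights_row)

text \<open>
  The entry $(m,j)$ stands for the paths with $j+1$ summands.
\<close>

definition tri_mean :: "nat \<Rightarrow> nat \<Rightarrow> real" where
  "tri_mean d n = tri_avg d n (\<lambda>(m, j). real j + 1)"

definition tri_var :: "nat \<Rightarrow> nat \<Rightarrow> real" where
  "tri_var d n = tri_avg d n (\<lambda>(m, j). (real j + 1 - tri_mean d n)\<^sup>2)"

definition gap_mean :: "nat \<Rightarrow> nat \<Rightarrow> real" where
  "gap_mean d n = len_avg d n (\<lambda>m. real n - real m)"

text \<open>
  Gaps are integers and at least 1 on the rows below \<open>n\<close>, so they are dominated by their squares.
\<close>

lemma gap_mean_bounds:
  assumes "1 \<le> d" "1 \<le> n"
  shows "0 \<le> gap_mean d n" "gap_mean d n \<le> 12"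
proof -
  show "0 \<le> gap_mean d n"
    unfolding gap_mean_def by (intro len_avg_nonneg assms) auto
  have "gap_mean d n \<le> len_avg d n (\<lambda>m. (real n - real m)\<^sup>2)"
    unfolding gap_mean_def
  proof (intro len_avg_mono assms)
    fix m assume "m \<in> {..<n}"
    then have "1 \<le> real n - real m" by (simp add: nat_less_real_le)
    then show "real n - real m \<le> (real n - real m)\<^sup>2" by (simp add: power2_eq_square)
  qed
  also have "\<dots> \<le> 12" by (rule len_avg_gap_sq_le[OF assms])
  finally show "gap_mean d n \<le> 12" .
qed

lemma gap_variance_bounds:
  assumes "1 \<le> d" "1 \<le> n"
  shows "0 \<le> len_avg d n (\<lambda>m. (gap_mean d n - (real n - real m))\<^sup>2)"
    and "len_avg d n (\<lambda>m. (gap_mean d n - (real n - real m))\<^sup>2) \<le> 12"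
proof -
  let ?g = "gap_mean d n"
  show "0 \<le> len_avg d n (\<lambda>m. (?g - (real n - real m))\<^sup>2)"
    by (intro len_avg_nonneg assms) auto
  have "len_avg d n (\<lambda>m. (?g - (real n - real m))\<^sup>2) =
      len_avg d n (\<lambda>m. (real n - real m)\<^sup>2 - (2 * ?g * (real n - real m) - ?g\<^sup>2))"
    by (intro arg_cong[where f = "len_avg d n"] ext) (simp add: power2_eq_square algebra_simps)
  also have "\<dots> = len_avg d n (\<lambda>m. (real n - real m)\<^sup>2) - (2 * ?g * ?g - ?g\<^sup>2)"
    unfolding len_avg_diff[of d n "\<lambda>m. (real n - real m)\<^sup>2"] len_avg_diff[of d n _ "\<lambda>_. ?g\<^sup>2"]
      len_avg_cmult[of d n "2 * ?g"] len_avg_const[OF assms(2)]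
    by (simp add: gap_mean_def)
  also have "\<dots> \<le> 12"
    using len_avg_gap_sq_le[OF assms] zero_le_power2[of ?g] unfolding power2_eq_square[of ?g] by linarith
  finally show "len_avg d n (\<lambda>m. (?g - (real n - real m))\<^sup>2) \<le> 12" .
qed

lemma tri_mean_eq:
  assumes "1 \<le> n"
  shows "tri_mean d n = 1 + real n / 2 - gap_mean d n / 2"
proof -
  have "row_avg d m (\<lambda>j. real j + 1) = 1 + real m / 2" for m
  proof -
    have "row_avg d m (\<lambda>j. real j + 1) = row_avg d m (\<lambda>j. dev m j + (1 + real m / 2))"
      by (intro row_avg_cong) (simp add: dev_def)
    also have "\<dots> = row_avg d m (dev m) + (1 + real m / 2)"
      by (simp only: row_avg_add row_avg_const)
    finally show ?thesis by (simp add: row_avg_dev)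
  qed
  then have "tri_mean d n = len_avg d n (\<lambda>m. 1 + real m / 2)"
    by (simp only: tri_mean_def tri_avg_eq case_prod_conv)
  also have "\<dots> = len_avg d n (\<lambda>m. (1 + real n / 2) - 1 / 2 * (real n - real m))"
    by (intro arg_cong[where f = "len_avg d n"] ext) (simp add: field_simps)
  also have "\<dots> = (1 + real n / 2) - 1 / 2 * gap_mean d n"
    unfolding gap_mean_def by (simp only: len_avg_diff[of _ _ "\<lambda>_. 1 + real n / 2"] len_avg_cmult len_avg_const[OF assms])
  finally show ?thesis by simp
qed

text \<open>
  The centred number of summands splits into the deviation within the row and the centred position
  of the row. The first part has mean zero in every row, so the two are uncorrelated.
\<close>

lemma centred_eq:
  assumes "1 \<le> n"
  shows "real j + 1 - tri_mean d n = dev m j + (gap_mean d n - (real n - real m)) / 2"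
  unfolding tri_mean_eq[OF assms] dev_def by (simp add: field_simps)

lemma tri_var_eq:
  assumes "1 \<le> n"
  shows "tri_var d n = len_avg d n (\<lambda>m. row_avg d m (\<lambda>j. (dev m j)\<^sup>2)) +
           len_avg d n (\<lambda>m. (gap_mean d n - (real n - real m))\<^sup>2) / 4"
proof -
  define c where "c = (\<lambda>m. gap_mean d n - (real n - real m))"
  have "row_avg d m (\<lambda>j. (dev m j + c m / 2)\<^sup>2) = row_avg d m (\<lambda>j. (dev m j)\<^sup>2) + 1 / 4 * (c m)\<^sup>2" for m
  proof -
    have "row_avg d m (\<lambda>j. (dev m j + c m / 2)\<^sup>2) =
        row_avg d m (\<lambda>j. (dev m j)\<^sup>2 + (c m * dev m j + 1 / 4 * (c m)\<^sup>2))"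
      by (simp add: power2_sum power_divide algebra_simps)
    also have "\<dots> = row_avg d m (\<lambda>j. (dev m j)\<^sup>2) + (c m * row_avg d m (dev m) + 1 / 4 * (c m)\<^sup>2)"
      by (simp only: row_avg_add row_avg_cmult row_avg_const)
    finally show ?thesis by (simp add: row_avg_dev)
  qed
  moreover have "tri_var d n = len_avg d n (\<lambda>m. row_avg d m (\<lambda>j. (dev m j + c m / 2)\<^sup>2))"
    unfolding tri_var_def tri_avg_eq case_prod_conv c_def
    by (intro arg_cong[where f = "len_avg d n"] arg_cong[where f = "row_avg d _"]
        arg_cong[where f = "\<lambda>x. x\<^sup>2"] ext centred_eq assms)
  ultimately have "tri_var d n = len_avg d n (\<lambda>m. row_avg d m (\<lambda>j. (dev m j)\<^sup>2) + 1 / 4 * (c m)\<^sup>2)"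
    by simp
  also have "\<dots> = len_avg d n (\<lambda>m. row_avg d m (\<lambda>j. (dev m j)\<^sup>2)) + 1 / 4 * len_avg d n (\<lambda>m. (c m)\<^sup>2)"
    by (simp only: len_avg_add len_avg_cmult)
  finally show ?thesis by (simp add: c_def)
qed

text \<open>
  Only the last few rows matter: the rows contribute $m/(4d)$ with $m$ close to $n$, and the variance
  of the position of the row is bounded.
\<close>

lemma tri_var_asymp:
  assumes d: "1 \<le> d" and n: "1 \<le> n"
  shows "\<bar>4 * real d * tri_var d n - real n\<bar> \<le> 18 * 16 ^ d * sqrt (real n) + 12 * (1 + real d)"
proof -
  let ?v = "\<lambda>m. row_avg d m (\<lambda>j. (dev m j)\<^sup>2)"
  let ?g = "len_avg d n (\<lambda>m. (gap_mean d n - (real n - real m))\<^sup>2)"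
  have "\<bar>len_avg d n (\<lambda>m. 4 * real d * ?v m - real m)\<bar> \<le> len_avg d n (\<lambda>m. 18 * 16 ^ d * sqrt (real n))"
    unfolding real_norm_def[symmetric]
  proof (intro norm_len_avg_le n)
    fix m assume m: "m \<in> {..<n}"
    have "\<bar>4 * real d * ?v m - real m\<bar> \<le> 18 * 16 ^ d * sqrt (real m)" by (rule row_avg_dev_sq_asymp[OF d])
    also have "\<dots> \<le> 18 * 16 ^ d * sqrt (real n)" using m by (intro mult_left_mono) auto
    finally show "norm (4 * real d * ?v m - real m) \<le> 18 * 16 ^ d * sqrt (real n)" by simp
  qed
  also have "\<dots> = 18 * 16 ^ d * sqrt (real n)" by (rule len_avg_const[OF n])
  finally have 1: "\<bar>len_avg d n (\<lambda>m. 4 * real d * ?v m - real m)\<bar> \<le> 18 * 16 ^ d * sqrt (real n)" .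
  have "len_avg d n (\<lambda>m. 4 * real d * ?v m - real m) =
      len_avg d n (\<lambda>m. 4 * real d * ?v m + (real n - real m) - real n)" by simp
  also have "\<dots> = 4 * real d * len_avg d n ?v + gap_mean d n - real n"
    unfolding gap_mean_def
    by (simp only: len_avg_diff[of _ _ _ "\<lambda>_. real n"] len_avg_add len_avg_cmult len_avg_const[OF n])
  finally have 2: "4 * real d * len_avg d n ?v - real n = len_avg d n (\<lambda>m. 4 * real d * ?v m - real m) - gap_mean d n"
    by simp
  have "4 * real d * tri_var d n - real n =
      len_avg d n (\<lambda>m. 4 * real d * ?v m - real m) - gap_mean d n + real d * ?g"
    unfolding tri_var_eq[OF n] 2[symmetric] by (simp add: algebra_simps)
  moreover have "0 \<le> real d * ?g" "real d * ?g \<le> real d * 12"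
    using gap_variance_bounds[OF d n] by (auto intro!: mult_left_mono)
  ultimately show ?thesis using 1 gap_mean_bounds[OF d n] by (simp add: abs_le_iff)
qed

lemma tri_var_ratio_tendsto:
  assumes d: "1 \<le> d"
  shows "(\<lambda>n. 4 * real d * tri_var d n / real n) \<longlonglongrightarrow> 1"
proof (rule LIM_zero_cancel, rule Lim_null_comparison)
  show "\<forall>\<^sub>F n in sequentially. norm (4 * real d * tri_var d n / real n - 1) \<le>
      (18 * 16 ^ d * sqrt (real n) + 12 * (1 + real d)) / real n"
    using eventually_ge_at_top[of 1]
  proof eventually_elim
    case (elim n)
    have "4 * real d * tri_var d n / real n - 1 = (4 * real d * tri_var d n - real n) / real n"
      using elim by (simp add: diff_divide_distrib)
    then have "norm (4 * real d * tri_var d n / real n - 1) = \<bar>4 * real d * tri_var d n - real n\<bar> / real n"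
      by simp
    also have "\<dots> \<le> (18 * 16 ^ d * sqrt (real n) + 12 * (1 + real d)) / real n"
      by (intro divide_right_mono tri_var_asymp[OF d elim]) auto
    finally show ?case .
  qed
  show "(\<lambda>n. (18 * 16 ^ d * sqrt (real n) + 12 * (1 + real d)) / real n) \<longlonglongrightarrow> 0"
    by real_asymp
qed

lemma scale_ratio_tendsto:
  assumes d: "1 \<le> d"
  shows "(\<lambda>n. sqrt (real n) / (2 * sqrt (real d)) / sqrt (tri_var d n)) \<longlonglongrightarrow> 1"
proof -
  have "(\<lambda>n. sqrt (inverse (4 * real d * tri_var d n / real n))) \<longlonglongrightarrow> sqrt (inverse 1)"
    by (intro tendsto_intros tri_var_ratio_tendsto d) auto
  moreover have "sqrt (inverse (4 * real d * tri_var d n / real n)) =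
      sqrt (real n) / (2 * sqrt (real d)) / sqrt (tri_var d n)" for n
    by (simp add: real_sqrt_divide real_sqrt_mult)
  ultimately show ?thesis by simp
qed

lemma norm_iexp_diff_le: "norm (iexp x - iexp y) \<le> \<bar>x - y\<bar>"
proof -
  have "iexp x - iexp y = iexp y * (iexp (x - y) - 1)"
    by (simp add: right_diff_distrib of_real_diff flip: exp_add)
  then have "norm (iexp x - iexp y) = norm (iexp (x - y) - 1)" by (simp add: norm_mult)
  also have "\<dots> \<le> \<bar>x - y\<bar>" using iexp_approx1[of "x - y" 0] by simp
  finally show ?thesis .
qed

text \<open>
  Rescaling a row by \<open>s\<close> instead of its own $b/r$, where $b = \sqrt m$, $r = 2\sqrt d$, costs
  a relative error $|1 - b/(rs)|$. It is compared with $|1 - a/(rs)|$ for $a = \sqrt n$, which does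
  not depend on the row, by means of $a - b \le (n-m)/a$.
\<close>

lemma scaling_error:
  fixes d n m j :: nat and s :: real
  assumes d: "1 \<le> d" and m: "m < n" and j: "j \<le> m" and s: "s > 0"
  defines "z \<equiv> row_step d m * dev m j"
  shows "\<bar>z - dev m j / s\<bar> \<le> \<bar>1 - sqrt (real n) / (2 * sqrt (real d)) / s\<bar> * \<bar>z\<bar>
       + (z\<^sup>2 + (real n - real m)\<^sup>2) / (2 * sqrt (real n) * s)"
proof (cases "m = 0")
  case True
  with j have "dev m j = 0" by (simp add: dev_def)
  with s show ?thesis by (simp add: z_def)
next
  case False
  define r where "r = 2 * sqrt (real d)"
  define a where "a = sqrt (real n)"
  define b where "b = sqrt (real m)"
  have "1 \<le> sqrt (real d)" using d by simp
  then have r: "1 \<le> r" unfolding r_def by linarith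
  have a: "0 < a" "a * a = real n" and b: "0 < b" "b * b = real m" and ab: "b \<le> a"
    using m False by (auto simp: a_def b_def)
  have dev: "dev m j = z * (b / r)"
    using d False by (simp add: z_def row_step_def r_def b_def real_sqrt_divide)
  have gap: "(a - b) / r \<le> (real n - real m) / a"
  proof -
    have "(a - b) / r \<le> (a - b) / 1" using r ab by (intro divide_left_mono) auto
    also have "a - b \<le> (real n - real m) / a"
      using a b ab mult_right_mono[OF ab, of b] by (simp add: field_simps)
    finally show ?thesis by simp
  qed
  have "z - dev m j / s = (1 - a / r / s) * z + (a - b) / r / s * z"
    unfolding dev using r s by (simp add: field_simps)
  then have "\<bar>z - dev m j / s\<bar> \<le> \<bar>1 - a / r / s\<bar> * \<bar>z\<bar> + (a - b) / r / s * \<bar>z\<bar>"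
    using abs_triangle_ineq[of "(1 - a / r / s) * z" "(a - b) / r / s * z"] r s ab
    by (simp add: abs_mult)
  moreover have "(a - b) / r / s * \<bar>z\<bar> \<le> (real n - real m) / a / s * \<bar>z\<bar>"
    using gap s by (intro mult_right_mono divide_right_mono) auto
  moreover have "\<dots> \<le> (z\<^sup>2 + (real n - real m)\<^sup>2) / (2 * a * s)"
  proof -
    have "2 * ((real n - real m) * \<bar>z\<bar>) \<le> z\<^sup>2 + (real n - real m)\<^sup>2"
      using zero_le_power2[of "\<bar>z\<bar> - (real n - real m)"] unfolding power2_diff by (simp add: mult_ac)
    then have "2 * ((real n - real m) * \<bar>z\<bar>) / (2 * a * s) \<le> (z\<^sup>2 + (real n - real m)\<^sup>2) / (2 * a * s)"
      using a s by (intro divide_right_mono) auto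
    then show ?thesis by simp
  qed
  ultimately show ?thesis unfolding a_def r_def by linarith
qed

lemma row_char_scaling_error:
  fixes c s :: real
  assumes d: "1 \<le> d" and m: "m < n" and s: "s > 0"
  shows "norm (row_avg d m (\<lambda>j. iexp (t * ((dev m j + c) / s))) - row_char d m t) \<le>
     \<bar>t\<bar> * (\<bar>1 - sqrt (real n) / (2 * sqrt (real d)) / s\<bar> * 2 ^ d
       + (2 ^ d + (real n - real m)\<^sup>2) / (2 * sqrt (real n) * s) + \<bar>c\<bar> / s)"
proof -
  let ?z = "\<lambda>j. row_step d m * dev m j"
  let ?\<rho> = "\<bar>1 - sqrt (real n) / (2 * sqrt (real d)) / s\<bar>"
  let ?k = "1 / (2 * sqrt (real n) * s)"
  have "norm (row_avg d m (\<lambda>j. iexp (t * ((dev m j + c) / s)) - iexp (t * ?z j))) \<le>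
      row_avg d m (\<lambda>j. \<bar>t\<bar> * ((?\<rho> * \<bar>?z j\<bar> + ?k * (?z j)\<^sup>2) + (?k * (real n - real m)\<^sup>2 + \<bar>c\<bar> / s)))"
  proof (rule norm_row_avg_le)
    fix j assume "j \<in> {..m}"
    then have "\<bar>?z j - dev m j / s\<bar> \<le> ?\<rho> * \<bar>?z j\<bar> + ?k * (?z j)\<^sup>2 + ?k * (real n - real m)\<^sup>2"
      using scaling_error[OF d m _ s, of j] by (simp add: add_divide_distrib)
    moreover have "\<bar>(dev m j + c) / s - ?z j\<bar> \<le> \<bar>?z j - dev m j / s\<bar> + \<bar>c / s\<bar>"
      unfolding add_divide_distrib by linarith
    ultimately have "\<bar>(dev m j + c) / s - ?z j\<bar> \<le>
        (?\<rho> * \<bar>?z j\<bar> + ?k * (?z j)\<^sup>2) + (?k * (real n - real m)\<^sup>2 + \<bar>c\<bar> / s)"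
      using s by simp
    then have "\<bar>t\<bar> * \<bar>(dev m j + c) / s - ?z j\<bar> \<le>
        \<bar>t\<bar> * ((?\<rho> * \<bar>?z j\<bar> + ?k * (?z j)\<^sup>2) + (?k * (real n - real m)\<^sup>2 + \<bar>c\<bar> / s))"
      by (intro mult_left_mono) auto
    then show "norm (iexp (t * ((dev m j + c) / s)) - iexp (t * ?z j)) \<le>
        \<bar>t\<bar> * ((?\<rho> * \<bar>?z j\<bar> + ?k * (?z j)\<^sup>2) + (?k * (real n - real m)\<^sup>2 + \<bar>c\<bar> / s))"
      using norm_iexp_diff_le[of "t * ((dev m j + c) / s)" "t * ?z j"]
      unfolding right_diff_distrib[symmetric] abs_mult by linarith
  qed
  also have "\<dots> = \<bar>t\<bar> * ((?\<rho> * row_avg d m (\<lambda>j. \<bar>?z j\<bar>) + ?k * row_avg d m (\<lambda>j. (?z j)\<^sup>2))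
      + (?k * (real n - real m)\<^sup>2 + \<bar>c\<bar> / s))"
    by (simp only: row_avg_add row_avg_cmult row_avg_const)
  also have "\<dots> \<le> \<bar>t\<bar> * ((?\<rho> * 2 ^ d + ?k * 2 ^ d) + (?k * (real n - real m)\<^sup>2 + \<bar>c\<bar> / s))"
    using s by (intro mult_left_mono add_mono row_avg_abs_std_le row_avg_std_sq_le d order_refl) auto
  finally show ?thesis
    by (simp add: row_char_def row_avg_diff add_divide_distrib add.assoc)
qed

text \<open>
  The average of the row characteristic functions converges by \<open>len_avg_tendsto\<close>. The
  characteristic function of the globally standardised variable differs from it by at most $|t|$
  times the mean distance of the two standardisations, for which \<open>bnd\<close> is a null sequence.
\<close>

theorem tri_char_tendsto:
  assumes d: "1 \<le> d"
  shows "(\<lambda>n. tri_avg d n (\<lambda>(m, j). iexp (t * ((real j + 1 - tri_mean d n) / sqrt (tri_var d n)))))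
    \<longlonglongrightarrow> of_real (exp (- (t\<^sup>2) / 2))"
proof (rule Lim_transform[OF len_avg_tendsto[OF row_char_tendsto[OF d, of t], of d]], rule Lim_null_comparison)
  define \<rho> where "\<rho> = (\<lambda>n. sqrt (real n) / (2 * sqrt (real d)) / sqrt (tri_var d n))"
  define bnd where "bnd = (\<lambda>n. \<bar>t\<bar> * (\<bar>1 - \<rho> n\<bar> * 2 ^ d
      + (2 ^ d + 12) * (1 / (2 * sqrt (real n) * sqrt (tri_var d n))) + 7 / (2 * sqrt (tri_var d n))))"
  have \<rho>: "\<rho> \<longlonglongrightarrow> 1" unfolding \<rho>_def by (rule scale_ratio_tendsto[OF d])
  have inv: "(\<lambda>n. 1 / sqrt (tri_var d n)) \<longlonglongrightarrow> 0"
  proof (rule Lim_transform_eventually)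
    have "(\<lambda>n. \<rho> n * (2 * sqrt (real d) / sqrt (real n))) \<longlonglongrightarrow> 1 * 0"
      by (intro tendsto_mult \<rho>) real_asymp
    then show "(\<lambda>n. \<rho> n * (2 * sqrt (real d) / sqrt (real n))) \<longlonglongrightarrow> 0" by simp
    show "\<forall>\<^sub>F n in sequentially. \<rho> n * (2 * sqrt (real d) / sqrt (real n)) = 1 / sqrt (tri_var d n)"
      using eventually_gt_at_top[of 0] by eventually_elim (use d in \<open>simp add: \<rho>_def\<close>)
  qed
  have inv': "(\<lambda>n. 1 / (2 * sqrt (real n) * sqrt (tri_var d n))) \<longlonglongrightarrow> 0"
  proof -
    have "(\<lambda>n. 1 / (2 * sqrt (real n)) * (1 / sqrt (tri_var d n))) \<longlonglongrightarrow> 0 * 0"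
      by (intro tendsto_mult inv) real_asymp
    then show ?thesis by simp
  qed
  have "bnd \<longlonglongrightarrow> \<bar>t\<bar> * (\<bar>1 - 1\<bar> * 2 ^ d + (2 ^ d + 12) * 0 + 7 / 2 * 0)"
    unfolding bnd_def using tendsto_mult[OF tendsto_const inv, of "7/2"]
    by (intro tendsto_intros \<rho> inv') simp
  then show "bnd \<longlonglongrightarrow> 0" by simp
  have "\<forall>\<^sub>F n in sequentially. 0 < 4 * real d * tri_var d n / real n"
    using order_tendstoD(1)[OF tri_var_ratio_tendsto[OF d], of 0] by simp
  then show "\<forall>\<^sub>F n in sequentially. norm (tri_avg d n (\<lambda>(m, j). iexp (t * ((real j + 1 - tri_mean d n) / sqrt (tri_var d n)))) -
      len_avg d n (\<lambda>m. row_char d m t)) \<le> bnd n"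
    using eventually_ge_at_top[of 1]
  proof eventually_elim
    case (elim n)
    define s where "s = sqrt (tri_var d n)"
    define c where "c = (\<lambda>m. (gap_mean d n - (real n - real m)) / 2)"
    have s: "s > 0" using elim(1,2) d by (auto simp: s_def zero_less_divide_iff zero_less_mult_iff)
    let ?k = "1 / (2 * sqrt (real n) * s)"
    have eq: "tri_avg d n (\<lambda>(m, j). iexp (t * ((real j + 1 - tri_mean d n) / s))) =
        len_avg d n (\<lambda>m. row_avg d m (\<lambda>j. iexp (t * ((dev m j + c m) / s))))"
      unfolding tri_avg_eq case_prod_conv c_def
      by (intro arg_cong[where f = "len_avg d n"] arg_cong[where f = "row_avg d _"]
          arg_cong[where f = "\<lambda>x. iexp (t * (x / s))"] ext centred_eq elim(2))
    have "norm (len_avg d n (\<lambda>m. row_char d m t - row_avg d m (\<lambda>j. iexp (t * ((dev m j + c m) / s))))) \<le>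
        len_avg d n (\<lambda>m. \<bar>t\<bar> * ((\<bar>1 - \<rho> n\<bar> * 2 ^ d + ?k * 2 ^ d) +
          (?k * (real n - real m)\<^sup>2 + 1 / s * ((c m)\<^sup>2 + 1 / 4))))"
    proof (rule norm_len_avg_le[OF elim(2)])
      fix m assume "m \<in> {..<n}"
      then have m: "m < n" by simp
      have "\<bar>c m\<bar> \<le> (c m)\<^sup>2 + 1 / 4"
        using zero_le_power2[of "\<bar>c m\<bar> - 1 / 2"] unfolding power2_diff by (simp add: power2_eq_square)
      then have "\<bar>c m\<bar> / s \<le> 1 / s * ((c m)\<^sup>2 + 1 / 4)"
        using s by (simp add: field_simps)
      then have "\<bar>t\<bar> * (\<bar>1 - \<rho> n\<bar> * 2 ^ d + (2 ^ d + (real n - real m)\<^sup>2) / (2 * sqrt (real n) * s) + \<bar>c m\<bar> / s) \<le>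
         \<bar>t\<bar> * ((\<bar>1 - \<rho> n\<bar> * 2 ^ d + ?k * 2 ^ d) + (?k * (real n - real m)\<^sup>2 + 1 / s * ((c m)\<^sup>2 + 1 / 4)))"
        by (intro mult_left_mono) (simp_all add: add_divide_distrib)
      with row_char_scaling_error[OF d m s, of t "c m"]
      show "norm (row_char d m t - row_avg d m (\<lambda>j. iexp (t * ((dev m j + c m) / s)))) \<le>
         \<bar>t\<bar> * ((\<bar>1 - \<rho> n\<bar> * 2 ^ d + ?k * 2 ^ d) + (?k * (real n - real m)\<^sup>2 + 1 / s * ((c m)\<^sup>2 + 1 / 4)))"
        unfolding norm_minus_commute[of "row_char d m t"] \<rho>_def s_def by linarith
    qed
    also have "\<dots> = \<bar>t\<bar> * ((\<bar>1 - \<rho> n\<bar> * 2 ^ d + ?k * 2 ^ d) +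
          (?k * len_avg d n (\<lambda>m. (real n - real m)\<^sup>2) + 1 / s * (len_avg d n (\<lambda>m. (c m)\<^sup>2) + 1 / 4)))"
      by (simp only: len_avg_add len_avg_cmult len_avg_const[OF elim(2)])
    also have "\<dots> \<le> \<bar>t\<bar> * ((\<bar>1 - \<rho> n\<bar> * 2 ^ d + ?k * 2 ^ d) + (?k * 12 + 1 / s * (3 + 1 / 4)))"
    proof -
      have "len_avg d n (\<lambda>m. (c m)\<^sup>2) = 1 / 4 * len_avg d n (\<lambda>m. (gap_mean d n - (real n - real m))\<^sup>2)"
        unfolding len_avg_cmult[symmetric] c_def by (simp add: power_divide)
      then have "len_avg d n (\<lambda>m. (c m)\<^sup>2) \<le> 3" using gap_variance_bounds(2)[OF d elim(2)] by simp
      then show ?thesis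
        using s by (intro mult_left_mono add_mono len_avg_gap_sq_le d elim(2) order_refl) auto
    qed
    also have "\<dots> \<le> bnd n"
    proof -
      have shuffle: "x + k * y + (k * 12 + z) \<le> x + (y + 12) * k + z'" if "z \<le> z'" for x y k z z' :: real
        using that by (simp add: algebra_simps)
      have "1 / s * (3 + 1 / 4) \<le> 7 / (2 * s)" using s by (simp add: field_simps)
      then show ?thesis
        unfolding bnd_def s_def[symmetric] by (intro mult_left_mono shuffle abs_ge_zero)
    qed
    finally show ?case
      unfolding s_def[symmetric] by (simp only: eq len_avg_diff norm_minus_commute)
  qed
qed

section \<open>Counting simple jump paths\<close>

definition paths :: "nat ^ 'd::finite \<Rightarrow> nat \<Rightarrow> (nat ^ 'd) list set" where
  "paths a k = {xs. simple_jump_path a k xs}"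

lemma positive_points_nonzero: "x \<in> positive_points \<Longrightarrow> x \<noteq> 0"
  by (auto simp: positive_points_def)

lemma simple_jump_path_1: "simple_jump_path a (Suc 0) xs \<longleftrightarrow> a \<in> positive_points \<and> xs = [a, 0]"
  by (auto simp: simple_jump_path_def length_Suc_conv strictly_below_def positive_points_def)

text \<open>
  The second point of a path with at least two steps is not the origin, since something lies strictly
  below it; so the tail is again a simple jump path.
\<close>

lemma simple_jump_path_Suc:
  "simple_jump_path a (Suc (Suc k)) xs \<longleftrightarrow>
     a \<in> positive_points \<and>
     (\<exists>b ys. xs = a # ys \<and> strictly_below b a \<and> simple_jump_path b (Suc k) ys)"
proof
  assume L: "simple_jump_path a (Suc (Suc k)) xs"
  then obtain ys where xs: "xs = a # ys" and len: "length ys = Suc (Suc k)"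
    by (auto simp: simple_jump_path_def length_Suc_conv)
  have step: "strictly_below (xs ! Suc i) (xs ! i)" if "i < Suc (Suc k)" for i
    using L that by (auto simp: simple_jump_path_def)
  have "strictly_below (ys ! 1) (ys ! 0)" using step[of 1] xs by simp
  then have "ys ! 0 \<noteq> 0" by (auto simp: strictly_below_def)
  moreover have "ys ! 0 \<in> set xs" using len xs by simp
  ultimately have "ys ! 0 \<in> positive_points" using L by (auto simp: simple_jump_path_def)
  moreover have "strictly_below (ys ! Suc i) (ys ! i)" if "i < Suc k" for i
    using step[of "Suc i"] that xs by simp
  ultimately have "simple_jump_path (ys ! 0) (Suc k) ys"
    using L xs len by (auto simp: simple_jump_path_def)
  moreover have "strictly_below (ys ! 0) a" using step[of 0] xs by simp
  ultimately show "a \<in> positive_points \<and>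
     (\<exists>b ys. xs = a # ys \<and> strictly_below b a \<and> simple_jump_path b (Suc k) ys)"
    using L xs by (auto simp: simple_jump_path_def)
next
  assume "a \<in> positive_points \<and>
     (\<exists>b ys. xs = a # ys \<and> strictly_below b a \<and> simple_jump_path b (Suc k) ys)"
  then show "simple_jump_path a (Suc (Suc k)) xs"
    by (auto simp: simple_jump_path_def less_Suc_eq_0_disj all_conj_distrib)
qed

definition below_points :: "nat ^ 'd::finite \<Rightarrow> (nat ^ 'd) set" where
  "below_points a = {b \<in> positive_points. strictly_below b a}"

lemma below_points_bij:
  "bij_betw (\<lambda>b. ($) b) (below_points a) (PiE UNIV (\<lambda>j. {1..<a $ j}))"
proof (rule bij_betw_byWitness[where f' = vec_lambda])
  show "($) ` below_points a \<subseteq> (\<Pi>\<^sub>E j\<in>UNIV. {1..<a $ j})"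
    by (auto simp: below_points_def positive_points_def strictly_below_def Suc_le_eq)
  show "vec_lambda ` (\<Pi>\<^sub>E j\<in>UNIV. {1..<a $ j}) \<subseteq> below_points a"
    by (auto simp: below_points_def positive_points_def strictly_below_def Suc_le_eq PiE_iff)
qed auto

lemma finite_below_points: "finite (below_points a)"
  using bij_betw_finite[OF below_points_bij[of a]] by (auto intro: finite_PiE)

lemma sum_choose_interval:
  assumes "0 < a"
  shows "(\<Sum>x\<in>{1..<a}. (x - 1) choose k) = (a - 1) choose Suc k"
proof (cases "a = 1")
  case False
  then obtain n where a: "a = Suc (Suc n)" using assms by (metis One_nat_def not0_implies_Suc less_numeral_extra(3))
  have "(\<Sum>x\<in>{1..<a}. (x - 1) choose k) = (\<Sum>x\<le>n. x choose k)"
    by (rule sum.reindex_bij_witness[of _ Suc "\<lambda>x. x - 1"]) (auto simp: a)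
  then show ?thesis using sum_choose_upper[of k n] by (simp add: a)
qed simp

lemma paths_Suc_Suc:
  assumes "a \<in> positive_points"
  shows "paths a (Suc (Suc k)) = (\<Union>b\<in>below_points a. (#) a ` paths b (Suc k))"
  using assms unfolding paths_def simple_jump_path_Suc below_points_def
  by (auto simp: simple_jump_path_def)

text \<open>
  Induction on the number of steps over the choice of the second point \<open>b\<close>: the sum over \<open>b\<close> of
  the product of binomial coefficients factors over the coordinates, and each factor is a hockey
  stick sum.
\<close>

lemma card_paths:
  fixes a :: "nat ^ 'd::finite"
  assumes "a \<in> positive_points"
  shows "finite (paths a (Suc k)) \<and> card (paths a (Suc k)) = (\<Prod>j\<in>UNIV. (a $ j - 1) choose k)"
  using assms
proof (induction k arbitrary: a)
  case 0
  then have "paths a (Suc 0) = {[a, 0]}" by (auto simp: paths_def simple_jump_path_1)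
  then show ?case by simp
next
  case (Suc k)
  have pos: "b \<in> positive_points" if "b \<in> below_points a" for b
    using that by (simp add: below_points_def)
  have fin: "finite (paths b (Suc k))" if "b \<in> below_points a" for b
    using Suc.IH[OF pos[OF that]] by blast
  have start: "xs ! 0 = b" if "xs \<in> paths b (Suc k)" for xs b
    using that by (simp add: paths_def simple_jump_path_def)
  have disj: "(#) a ` paths b (Suc k) \<inter> (#) a ` paths c (Suc k) = {}" if "b \<noteq> c" for b c
    using that by (auto dest!: start)
  have "card (paths a (Suc (Suc k))) = (\<Sum>b\<in>below_points a. card ((#) a ` paths b (Suc k)))"
    unfolding paths_Suc_Suc[OF Suc.prems]
    by (intro card_UN_disjoint finite_below_points) (use fin disj in auto)
  also have "\<dots> = (\<Sum>b\<in>below_points a. \<Prod>j\<in>UNIV. (b $ j - 1) choose k)"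
    using Suc.IH[OF pos] by (intro sum.cong refl) (simp add: card_image)
  also have "\<dots> = (\<Sum>g\<in>PiE UNIV (\<lambda>j. {1..<a $ j}). \<Prod>j\<in>UNIV. (g j - 1) choose k)"
    by (rule sum.reindex_bij_betw[OF below_points_bij, of "\<lambda>g. \<Prod>j\<in>UNIV. (g j - 1) choose k"])
  also have "\<dots> = (\<Prod>j\<in>UNIV. \<Sum>x\<in>{1..<a $ j}. (x - 1) choose k)"
    by (subst prod_sum_PiE) auto
  also have "\<dots> = (\<Prod>j\<in>UNIV. (a $ j - 1) choose Suc k)"
    using Suc.prems by (intro prod.cong refl sum_choose_interval) (auto simp: positive_points_def)
  finally show ?case
    using fin by (simp add: paths_Suc_Suc[OF Suc.prems] finite_below_points)
qed

lemma length_summands: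
  assumes "simple_jump_path a k xs"
  shows "length (summands xs) = k"
proof -
  have len: "length xs = Suc k" and last: "xs ! k = 0" and k: "1 \<le> k" using assms by (auto simp: simple_jump_path_def)
  have nz: "xs ! i \<noteq> 0" if "i < k" for i
  proof -
    have "strictly_below (xs ! Suc i) (xs ! i)" using assms that by (auto simp: simple_jump_path_def)
    then show ?thesis by (auto simp: strictly_below_def)
  qed
  have xs: "xs = take k xs @ [0]"
    using len last by (metis take_Suc_conv_app_nth lessI order_refl take_all)
  have "summands xs = take k xs"
    unfolding summands_def using nz len
    by (subst xs) (auto simp: filter_id_conv in_set_conv_nth simp del: take_append)
  then show ?thesis using len by simp
qed

definition diag :: "nat \<Rightarrow> nat ^ 'd::finite" where
  "diag i = (\<chi> j. i)"

lemma diagonal_paths_eq: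
  "diagonal_paths n = (\<Union>(m, j)\<in>Sigma {..<n} (\<lambda>m. {..m}). paths (diag (Suc m) :: nat ^ 'd::finite) (Suc j))"
  (is "?L = ?R")
proof
  have diag_pos: "(diag (Suc m) :: nat ^ 'd) \<in> positive_points" for m by (simp add: diag_def positive_points_def)
  show "?L \<subseteq> ?R"
  proof
    fix xs :: "(nat ^ 'd) list" assume "xs \<in> ?L"
    then obtain i k where i: "i \<in> {1..n}" and p: "simple_jump_path (\<chi> j. i) k xs"
      by (auto simp: diagonal_paths_def)
    define m j where "m = i - 1" and "j = k - 1"
    have ij: "i = Suc m" "k = Suc j" using i p by (auto simp: m_def j_def simple_jump_path_def)
    have xs: "xs \<in> paths (diag (Suc m)) (Suc j)" using p by (simp add: ij paths_def diag_def)
    \<comment> \<open>a positive count $\binom{m}{j}^d$ forces $j \le m$\<close>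
    have "card (paths (diag (Suc m) :: nat ^ 'd) (Suc j)) \<noteq> 0"
      using xs card_paths[OF diag_pos[of m], of j] by (metis card_0_eq empty_iff)
    then have "j \<le> m"
      using card_paths[OF diag_pos[of m], of j] by (auto simp: diag_def binomial_eq_0_iff)
    then show "xs \<in> ?R" using xs i ij by auto
  qed
  show "?R \<subseteq> ?L"
    by (force simp: diagonal_paths_def paths_def diag_def)
qed

text \<open>
  Paths with different starting points or different numbers of steps are different.
\<close>

lemma sum_diagonal_paths:
  fixes f :: "real \<Rightarrow> 'b::real_vector"
  shows "(\<Sum>xs\<in>(diagonal_paths n :: (nat ^ 'd::finite) list set). f (num_summands xs)) =
     (\<Sum>(m, j)\<in>Sigma {..<n} (\<lambda>m. {..m}). real (m choose j) ^ CARD('d) *\<^sub>R f (real j + 1))"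
proof -
  have diag_pos: "(diag (Suc m) :: nat ^ 'd) \<in> positive_points" for m by (simp add: diag_def positive_points_def)
  let ?P = "\<lambda>(m, j). paths (diag (Suc m) :: nat ^ 'd) (Suc j)"
  have disj: "?P x \<inter> ?P y = {}" if "x \<noteq> y" for x y
  proof -
    obtain m j m' j' where xy: "x = (m, j)" "y = (m', j')" by fastforce
    show ?thesis
    proof (rule ccontr)
      assume "?P x \<inter> ?P y \<noteq> {}"
      then obtain xs where "simple_jump_path (diag (Suc m) :: nat ^ 'd) (Suc j) xs"
        "simple_jump_path (diag (Suc m') :: nat ^ 'd) (Suc j') xs"
        by (auto simp: xy paths_def)
      then have "(diag (Suc m) :: nat ^ 'd) = diag (Suc m')" "j = j'"
        by (auto simp: simple_jump_path_def)
      then show False using that by (simp add: xy diag_def vec_eq_iff)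
    qed
  qed
  have fin: "finite (?P x)" for x using card_paths[OF diag_pos] by (cases x) auto
  have "(\<Sum>xs\<in>(diagonal_paths n :: (nat ^ 'd) list set). f (num_summands xs)) =
      (\<Sum>x\<in>Sigma {..<n} (\<lambda>m. {..m}). \<Sum>xs\<in>?P x. f (num_summands xs))"
    unfolding diagonal_paths_eq
    using disj fin by (intro sum.UNION_disjoint) auto
  also have "\<dots> = (\<Sum>(m, j)\<in>Sigma {..<n} (\<lambda>m. {..m}). real (m choose j) ^ CARD('d) *\<^sub>R f (real j + 1))"
  proof (rule sum.cong[OF refl], clarify)
    fix m j
    have "(\<Sum>xs\<in>paths (diag (Suc m) :: nat ^ 'd) (Suc j). f (num_summands xs)) =
        (\<Sum>xs\<in>paths (diag (Suc m) :: nat ^ 'd) (Suc j). f (real j + 1))"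
      by (intro sum.cong refl) (auto simp: num_summands_def paths_def add.commute dest!: length_summands)
    also have "\<dots> = real (m choose j) ^ CARD('d) *\<^sub>R f (real j + 1)"
      using card_paths[OF diag_pos[of m], of j] by (simp add: diag_def sum_constant_scaleR)
    finally show "(\<Sum>xs\<in>paths (diag (Suc m) :: nat ^ 'd) (Suc j). f (num_summands xs)) =
        real (m choose j) ^ CARD('d) *\<^sub>R f (real j + 1)" .
  qed
  finally show ?thesis .
qed

lemma finite_diagonal_paths: "finite (diagonal_paths n :: (nat ^ 'd::finite) list set)"
proof -
  have "finite (paths (diag (Suc m) :: nat ^ 'd) (Suc j))" for m j
    using card_paths[of "diag (Suc m) :: nat ^ 'd" j] by (simp add: diag_def positive_points_def)
  then show ?thesis unfolding diagonal_paths_eq by auto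
qed

lemma short_path_in_diagonal_paths:
  assumes "1 \<le> n"
  shows "[diag 1, 0] \<in> (diagonal_paths n :: (nat ^ 'd::finite) list set)"
proof -
  have "simple_jump_path (diag 1 :: nat ^ 'd) (Suc 0) [diag 1, 0]"
    by (simp add: simple_jump_path_1 diag_def positive_points_def)
  then show ?thesis using assms unfolding diagonal_paths_def diag_def by fastforce
qed

text \<open>
  This identifies the law of the number of summands: with row \<open>m\<close> for the start $(m+1,\dots,m+1)$
  and entry \<open>j\<close> for $j+1$ steps, everything about it is an average over the triangle.
\<close>

theorem expectation_num_summands:
  fixes f :: "real \<Rightarrow> 'b::{banach, second_countable_topology}"
  assumes "1 \<le> n"
  shows "measure_pmf.expectation (path_pmf n :: (nat ^ 'd::finite) list pmf) (\<lambda>xs. f (num_summands xs)) =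
     tri_avg CARD('d) n (\<lambda>(m, j). f (real j + 1))"
proof -
  let ?D = "diagonal_paths n :: (nat ^ 'd) list set"
  have ne: "?D \<noteq> {}" using short_path_in_diagonal_paths[OF assms] by blast
  note fin = finite_diagonal_paths[of n, where 'd = 'd]
  have "measure_pmf.expectation (path_pmf n :: (nat ^ 'd) list pmf) (\<lambda>xs. f (num_summands xs)) =
      (\<Sum>xs\<in>?D. f (num_summands xs)) /\<^sub>R real (card ?D)"
    unfolding path_pmf_def using ne fin
    by (subst integral_measure_pmf[OF fin]) (auto simp: scaleR_sum_right divide_inverse)
  also have "real (card ?D) = (\<Sum>(m, j)\<in>Sigma {..<n} (\<lambda>m. {..m}). real (m choose j) ^ CARD('d))"
    using sum_diagonal_paths[of "\<lambda>_. 1 :: real" n, where 'd = 'd] by simp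
  finally show ?thesis
    unfolding sum_diagonal_paths tri_avg_def wavg_def by (simp add: case_prod_unfold)
qed

section \<open>The distribution of the number of summands\<close>

text \<open>
  Labels are at least 1 because the first label is 1 and labels increase along the order.
\<close>

lemma represents_positive:
  fixes e :: "nat \<Rightarrow> nat ^ 'd::finite"
  assumes "jump_labelling e L" "xs \<in> diagonal_paths n"
  shows "\<exists>N>0. represents L xs N"
proof -
  obtain a k where p: "simple_jump_path a k xs" using assms(2) by (auto simp: diagonal_paths_def)
  have a: "a \<in> positive_points" "a \<in> set xs"
    using p by (auto simp: simple_jump_path_def intro!: nth_mem)
  have "a \<in> range e" using assms(1) a(1) by (simp add: jump_labelling_def bij_betw_def)
  then obtain m where m: "a = e m" by blast
  have "L (e 0) = 1" "mono (\<lambda>m. L (e m))"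
    using assms(1) by (auto simp: jump_labelling_def strict_mono_mono)
  then have "1 \<le> L a" unfolding m using monoD[of "\<lambda>m. L (e m)" 0 m] by simp
  moreover have "a \<in> set (summands xs)"
    using a positive_points_nonzero by (auto simp: summands_def)
  then have "L a \<le> sum_list (map L (summands xs))"
    by (intro member_le_sum_list) auto
  ultimately show ?thesis unfolding represents_def by auto
qed

text \<open>
  The paths $(1,\dots,1) \to 0$ and $(2,\dots,2) \to (1,\dots,1) \to 0$ have different numbers of
  summands, so one of them differs from the mean.
\<close>

lemma variance_num_summands_pos:
  assumes "2 \<le> n"
  shows "0 < measure_pmf.variance (path_pmf n :: (nat ^ 'd::finite) list pmf) num_summands"
proof -
  let ?D = "diagonal_paths n :: (nat ^ 'd) list set"
  let ?\<mu> = "measure_pmf.expectation (path_pmf n :: (nat ^ 'd) list pmf) num_summands"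
  let ?p = "[diag 1, 0] :: (nat ^ 'd) list" and ?q = "[diag 2, diag 1, 0] :: (nat ^ 'd) list"
  have p: "?p \<in> ?D" using assms by (intro short_path_in_diagonal_paths) auto
  have q': "simple_jump_path (diag 2 :: nat ^ 'd) (Suc (Suc 0)) ?q"
    unfolding simple_jump_path_Suc simple_jump_path_1
    by (auto simp: diag_def positive_points_def strictly_below_def)
  then have q: "?q \<in> ?D" using assms unfolding diagonal_paths_def diag_def by fastforce
  have ne: "?D \<noteq> {}" using p by blast
  note fin = finite_diagonal_paths[of n, where 'd = 'd]
  have "num_summands ?p = 1"
    using length_summands[of "diag 1" 1 ?p] by (simp add: num_summands_def simple_jump_path_1 diag_def positive_points_def)
  moreover have "num_summands ?q = 2" using length_summands[OF q'] by (simp add: num_summands_def)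
  ultimately have "num_summands ?p \<noteq> ?\<mu> \<or> num_summands ?q \<noteq> ?\<mu>" by linarith
  then obtain xs where xs: "xs \<in> ?D" "num_summands xs \<noteq> ?\<mu>" using p q by blast
  have "0 < (\<Sum>xs\<in>?D. (num_summands xs - ?\<mu>)\<^sup>2)"
    using xs by (intro sum_pos2[OF fin xs(1)]) auto
  then show ?thesis
    unfolding path_pmf_def using integral_pmf_of_set[OF ne fin] ne fin
    by (simp add: card_gt_0_iff path_pmf_def)
qed

theorem theorem1p1:
  shows "(\<forall>(e :: nat \<Rightarrow> nat ^ 'd::finite) L. jump_labelling e L \<longrightarrow>
            (\<forall>n. \<forall>xs \<in> diagonal_paths n. \<exists>N>0. represents L xs N)) \<and>
         (\<forall>n\<ge>2. 0 < measure_pmf.variance (path_pmf n :: (nat ^ 'd) list pmf) num_summands) \<and>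
         weak_conv_m
           (\<lambda>n. distr (path_pmf n :: (nat ^ 'd) list pmf) borel (standardized_num_summands n))
           std_normal_distribution"
proof (intro conjI allI impI ballI)
  fix e :: "nat \<Rightarrow> nat ^ 'd" and L n and xs :: "(nat ^ 'd) list"
  assume "jump_labelling e L" "xs \<in> diagonal_paths n"
  then show "\<exists>N>0. represents L xs N" by (rule represents_positive)
next
  fix n :: nat assume "2 \<le> n"
  then show "0 < measure_pmf.variance (path_pmf n :: (nat ^ 'd) list pmf) num_summands"
    by (rule variance_num_summands_pos)
next
  let ?M = "\<lambda>n. distr (path_pmf n :: (nat ^ 'd) list pmf) borel (standardized_num_summands n)"
  let ?d = "CARD('d)"
  show "weak_conv_m ?M std_normal_distribution"
  proof (rule levy_continuity)
    show "real_distribution (?M n)" for n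
      by (rule prob_space.real_distribution_distr[OF measure_pmf.prob_space_axioms]) simp
    show "real_distribution std_normal_distribution"
      by (rule real_dist_normal_dist)
    fix t
    \<comment> \<open>for $n = 0$ there are no paths and the law is a default value\<close>
    have char: "char (?M n) t = tri_avg ?d n (\<lambda>(m, j). iexp (t * ((real j + 1 - tri_mean ?d n) / sqrt (tri_var ?d n))))"
      if n: "1 \<le> n" for n
    proof -
      have mean: "measure_pmf.expectation (path_pmf n :: (nat ^ 'd) list pmf) num_summands = tri_mean ?d n"
        using expectation_num_summands[OF n, of "\<lambda>x. x", where 'd = 'd] by (simp add: tri_mean_def)
      have var: "measure_pmf.expectation (path_pmf n :: (nat ^ 'd) list pmf)
          (\<lambda>xs. (num_summands xs - tri_mean ?d n)\<^sup>2) = tri_var ?d n"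
        using expectation_num_summands[OF n, of "\<lambda>x. (x - tri_mean ?d n)\<^sup>2", where 'd = 'd]
        by (simp add: tri_var_def)
      have "char (?M n) t = measure_pmf.expectation (path_pmf n :: (nat ^ 'd) list pmf)
          (\<lambda>xs. iexp (t * ((num_summands xs - tri_mean ?d n) / sqrt (tri_var ?d n))))"
        unfolding char_def by (subst integral_distr) (simp_all add: standardized_num_summands_def mean var)
      then show ?thesis
        using expectation_num_summands[OF n, of "\<lambda>x. iexp (t * ((x - tri_mean ?d n) / sqrt (tri_var ?d n)))", where 'd = 'd]
        by simp
    qed
    have "(\<lambda>n. tri_avg ?d n (\<lambda>(m, j). iexp (t * ((real j + 1 - tri_mean ?d n) / sqrt (tri_var ?d n)))))
        \<longlonglongrightarrow> char std_normal_distribution t"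
      unfolding char_std_normal_distribution by (rule tri_char_tendsto) simp
    then show "(\<lambda>n. char (?M n) t) \<longlonglongrightarrow> char std_normal_distribution t"
      by (rule Lim_transform_eventually)
         (use eventually_ge_at_top[of 1] in eventually_elim, use char in simp)
  qed
qed

end
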